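(* Let $\lambda_A,\lambda_B,\lambda_C>0$ with $\lambda_C>|\lambda_A-\lambda_B|$, and put $\lambda_{\text{total}}=\lambda_A+\lambda_B+\lambda_C$. In the stationary regime of the 1v1 matchmaking system with side selection, in which players insisting on side A, players insisting on side B, and choice-free players arrive at rates $\lambda_A,\lambda_B,\lambda_C$ respectively, let $T_A,T_B,T_C$ denote the waiting times of these three types of players, let $T$ denote the waiting time of a generic player (of any type), and let $\pi_0$ be the stationary probability that no player is waiting. Then $$\mathbb{E}[T_A]=\frac{(\lambda_B+\lambda_C)\,\pi_0}{(\lambda_B+\lambda_C-\lambda_A)^2},\qquad \mathbb{E}[T_B]=\frac{(\lambda_A+\lambda_C)\,\pi_0}{(\lambda_A+\lambda_C-\lambda_B)^2},\qquad \mathbb{E}[T_C]=\frac{\pi_0}{\lambda_A+\lambda_B+\lambda_C},$$ where $$\pi_0=\left(\frac{\lambda_A}{\lambda_B+\lambda_C-\lambda_A}+\frac{\lambda_B}{\lambda_A+\lambda_C-\lambda_B}+\frac{\lambda_C}{\lambda_{\text{total}}}+1\right)^{-1},$$ and $$\mathbb{E}[T]=\frac{1}{2(\lambda_A+\lambda_C-\lambda_B)}+\frac{1}{2(\lambda_B+\lambda_C-\lambda_A)}+\frac{1}{\lambda_A+\lambda_B+\lambda_C}-\frac{1}{2\lambda_C}-\frac{\lambda_A+\lambda_B+2\lambda_C}{2(2\lambda_A\lambda_B+\lambda_A\lambda_C+\lambda_B\lambda_C+\lambda_C^2)}.$$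
   Context: Model: a 1v1 game has two sides A and B. Players insisting on side A, players insisting on side B, and choice-free players (who accept either side) arrive as independent Poisson processes of rates $\lambda_A,\lambda_B,\lambda_C$. Two players are matched, and leave instantaneously, as soon as they can take opposite sides; players of the same type are served in order of arrival. The system state is a continuous-time Markov chain on $\mathbb{Z}\cup\{1'\}$: state $i>0$ means that $i$ side-A players are waiting, state $-i<0$ means that $i$ side-B players are waiting, state $0$ means that the queue is empty, and state $1'$ means that one choice-free player is waiting. For every integer $i\ge0$ the rates are: $i\to i+1$ at rate $\lambda_A$; $i+1\to i$ at rate $\lambda_B+\lambda_C$; $-i\to-(i+1)$ at rate $\lambda_B$; $-(i+1)\to -i$ at rate $\lambda_A+\lambda_C$; in addition $0\to1'$ at rate $\lambda_C$ and $1'\to0$ at rate $\lambda_A+\lambda_B+\lambda_C$. The waiting time of a player is the time from its arrival until it is matched (zero if it is matched on arrival). A generic player is of type A, B, C with probability $\lambda_A/\lambda_{\text{total}}$, $\lambda_B/\lambda_{\text{total}}$, $\lambda_C/\lambda_{\text{total}}$ respectively, so $\mathbb{E}[T]=(\lambda_A\mathbb{E}[T_A]+\lambda_B\mathbb{E}[T_B]+\lambda_C\mathbb{E}[T_C])/\lambda_{\text{total}}$. *)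

theory Defs
  imports "HOL-Probability.Probability"
begin

datatype kind = SideA | SideB | Free

text \<open>States of the Markov chain: \<^term>\<open>Net i\<close> is the integer state \<open>i\<close>, and
  \<open>Lone_Free\<close> is the state \<open>1'\<close> with one choice-free player waiting.\<close>

datatype state = Net int | Lone_Free

fun rate :: "(kind \<Rightarrow> real) \<Rightarrow> state \<Rightarrow> state \<Rightarrow> real" where
  "rate lam (Net i) (Net j) =
     (if i \<ge> 0 \<and> j = i + 1 then lam SideA
      else if i > 0 \<and> j = i - 1 then lam SideB + lam Free
      else if i \<le> 0 \<and> j = i - 1 then lam SideB
      else if i < 0 \<and> j = i + 1 then lam SideA + lam Free
      else 0)"
| "rate lam (Net i) Lone_Free = (if i = 0 then lam Free else 0)"
| "rate lam Lone_Free (Net j) = (if j = 0 then lam SideA + lam SideB + lam Free else 0)"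
| "rate lam Lone_Free Lone_Free = 0"

text \<open>Invariance under the generator (global balance). All the sums have only finitely many
  nonzero terms.\<close>

definition stationary_distribution :: "(kind \<Rightarrow> real) \<Rightarrow> state pmf \<Rightarrow> bool" where
  "stationary_distribution lam \<pi> \<longleftrightarrow>
     (\<forall>y. (\<Sum>\<^sub>\<infinity>x. pmf \<pi> x * rate lam x y) = pmf \<pi> y * (\<Sum>\<^sub>\<infinity>z. rate lam y z))"

text \<open>A sample point consists of the state at time \<open>0\<close> and of the interarrival times after
  time \<open>0\<close>: \<open>g (k, n)\<close> is the time between the arrivals number \<open>n - 1\<close> and \<open>n\<close> of players of
  kind \<open>k\<close> (for \<open>n = 0\<close>, the time of the first one). Under \<open>system_space lam \<pi>\<close> the initial
  state has law \<open>\<pi>\<close> and is independent of the arrivals, which form independent Poisson processes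
  of rates \<open>lam k\<close>.\<close>

type_synonym sample = "state \<times> (kind \<times> nat \<Rightarrow> real)"

definition system_space :: "(kind \<Rightarrow> real) \<Rightarrow> state pmf \<Rightarrow> sample measure" where
  "system_space lam \<pi> =
     measure_pmf \<pi> \<Otimes>\<^sub>M
     Pi\<^sub>M UNIV (\<lambda>(k, n). density lborel (\<lambda>t. ennreal (exponential_density (lam k) t)))"

definition arrival_time :: "sample \<Rightarrow> kind \<Rightarrow> nat \<Rightarrow> real" where
  "arrival_time \<omega> k n = (\<Sum>j\<le>n. snd \<omega> (k, j))"

text \<open>Merging of the three arrival streams: \<open>arrived \<omega> m k\<close> is the number of players of kind \<open>k\<close>
  among the first \<open>m\<close> arrivals, and \<open>kind_at \<omega> m\<close>, \<open>time_at \<omega> m\<close> are the kind and the time of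
  arrival number \<open>m\<close> (counted from \<open>0\<close>). Simultaneous arrivals have probability \<open>0\<close>.\<close>

definition next_kind :: "sample \<Rightarrow> (kind \<Rightarrow> nat) \<Rightarrow> kind" where
  "next_kind \<omega> c = (ARG_MIN (\<lambda>k. arrival_time \<omega> k (c k)) k. True)"

primrec arrived :: "sample \<Rightarrow> nat \<Rightarrow> kind \<Rightarrow> nat" where
  "arrived \<omega> 0 = (\<lambda>_. 0)"
| "arrived \<omega> (Suc m) =
     (let c = arrived \<omega> m; k = next_kind \<omega> c in c(k := Suc (c k)))"

definition kind_at :: "sample \<Rightarrow> nat \<Rightarrow> kind" where
  "kind_at \<omega> m = next_kind \<omega> (arrived \<omega> m)"

definition time_at :: "sample \<Rightarrow> nat \<Rightarrow> real" where
  "time_at \<omega> m = arrival_time \<omega> (kind_at \<omega> m) (arrived \<omega> m (kind_at \<omega> m))"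

text \<open>A waiting player is \<open>(k, Some m)\<close> if it is arrival number \<open>m\<close>, and \<open>(k, None)\<close> if it was
  already waiting at time \<open>0\<close>. Queues are listed from oldest to newest.\<close>

type_synonym player = "kind \<times> nat option"

definition can_oppose :: "player \<Rightarrow> player \<Rightarrow> bool" where
  "can_oppose p q \<longleftrightarrow> fst p \<noteq> fst q \<or> fst p = Free"

fun arrive :: "player \<Rightarrow> player list \<Rightarrow> player list" where
  "arrive p [] = [p]"
| "arrive p (q # qs) = (if can_oppose p q then qs else q # arrive p qs)"

fun initial_queue :: "state \<Rightarrow> player list" where
  "initial_queue (Net i) =
     (if i \<ge> 0 then replicate (nat i) (SideA, None) else replicate (nat (- i)) (SideB, None))"
| "initial_queue Lone_Free = [(Free, None)]"

text \<open>\<open>queue \<omega> m\<close> is the queue just before arrival number \<open>m\<close>.\<close>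

primrec queue :: "sample \<Rightarrow> nat \<Rightarrow> player list" where
  "queue \<omega> 0 = initial_queue (fst \<omega>)"
| "queue \<omega> (Suc m) = arrive (kind_at \<omega> m, Some m) (queue \<omega> m)"

text \<open>The infimum is attained at the first arrival \<open>j \<ge> m\<close> after which player \<open>m\<close> is gone; it is
  \<open>\<infinity>\<close> if the player is never matched.\<close>

definition waiting_time :: "sample \<Rightarrow> nat \<Rightarrow> ennreal" where
  "waiting_time \<omega> m =
     (INF j \<in> {j. m \<le> j \<and> (kind_at \<omega> m, Some m) \<notin> set (queue \<omega> (Suc j))}.
        ennreal (time_at \<omega> j - time_at \<omega> m))"

text \<open>The typical player with kind in \<open>K\<close> in the stationary regime, in the sense of Palm: the
  measure \<open>system_space \<Otimes> counting\<close> on pairs of a sample point and an arrival number, restricted to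
  the players with kind in \<open>K\<close> arriving during one unit of time, and normalised. The integral of
  a function of the player is thus the expected sum of this function over those players, divided by
  their expected number.\<close>

definition typical_player ::
    "(kind \<Rightarrow> real) \<Rightarrow> state pmf \<Rightarrow> kind set \<Rightarrow> (sample \<times> nat) measure" where
  "typical_player lam \<pi> K =
     uniform_measure (system_space lam \<pi> \<Otimes>\<^sub>M count_space UNIV)
       {(\<omega>, m). kind_at \<omega> m \<in> K \<and> time_at \<omega> m \<le> 1}"

definition mean_waiting_time :: "(kind \<Rightarrow> real) \<Rightarrow> state pmf \<Rightarrow> kind set \<Rightarrow> ennreal" where
  "mean_waiting_time lam \<pi> K = (\<integral>\<^sup>+ (\<omega>, m). waiting_time \<omega> m \<partial>typical_player lam \<pi> K)"

end

theory Submission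
  imports Defs
begin

text \<open>Every state change happens at an arrival, and the total rate out of each state is the same. By the
  lack of memory of exponential clocks, the first arrival splits off: its time is exponential of the total
  rate, its kind is independent of this time, and both are independent of the arrivals that follow,
  which have the original law. Iterating, arrival number \<open>m\<close> finds the stationary state independently
  of its own time, so the number of arrivals in a unit of time cancels in the Palm expectation and the
  mean waiting time is an average over the stationary state. A player with \<open>i\<close> players ahead waits until
  \<open>i + 1\<close> opposing arrivals have occurred, on average \<open>(i + 1)\<close> over the opposing rate, and the
  stationary distribution is geometric on both sides of \<open>0\<close>.\<close>

section \<open>The superposition of the arrival streams\<close>

text \<open>The obstacle is that \<open>waiting_time\<close> and \<open>time_at\<close> are defined
  path by path through the merged streams, while stationarity is only a balance of rates. The map
  \<open>next_sample\<close> bridges the two: it restarts the sample just after its first arrival,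
  and its iterates express later kinds, later times and the kinds in the queue through a shifted
  sample. These identities hold for every sample; probability enters through the law of the pair
  (first arrival time, shifted sample), which is a product. The waiting time of arrival
  \<open>m\<close> then depends only on the state found, the kind and the clocks that follow. In the
  Palm ratio the common factor is the expected number of arrivals up to time 1; to cancel it in
  \<open>ennreal\<close> it must be known to be positive and finite. Finiteness is an issue a second
  time: the first-step equation for the mean time to a match is also solved by \<infinity>, which
  has to be excluded beforehand.\<close>

text \<open>Coordinate \<open>i\<close> is drawn separately and the others are read through
  \<open>g\<close> from a full independent copy; as \<open>g\<close> is injective off
  \<open>i\<close> and preserves the factors, they keep their joint law. With \<open>g = id\<close>
  one clock is resampled; with an index shift along one stream, the first clock of that stream is
  split off.\<close>

lemma nn_integral_PiM_reindex_upd: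
  fixes M :: "'i \<Rightarrow> 'a measure"
  assumes prob: "\<And>j. prob_space (M j)"
    and inj: "inj_on g (- {i})" and eq: "\<And>j. j \<noteq> i \<Longrightarrow> M (g j) = M j"
    and [measurable]: "F \<in> borel_measurable (PiM UNIV M)"
  shows "(\<integral>\<^sup>+w. F w \<partial>PiM UNIV M) =
    (\<integral>\<^sup>+s. \<integral>\<^sup>+w. F (\<lambda>j. if j = i then s else w (g j)) \<partial>PiM UNIV M \<partial>M i)"
proof -
  let ?R = "PiM (- {i}) M"
  interpret R: prob_space ?R using prob by (intro prob_space_PiM) auto
  have [measurable]: "(\<lambda>(x, X). X(i := x)) \<in> M i \<Otimes>\<^sub>M ?R \<rightarrow>\<^sub>M PiM UNIV M"
    by (simp add: case_prod_beta', rule measurable_fun_upd[where J="- {i}"]) auto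
  have U: "insert i (- {i}) = UNIV" by auto
  have *: "distr (M i \<Otimes>\<^sub>M ?R) (PiM UNIV M) (\<lambda>(x, X). X(i := x)) = PiM UNIV M"
    using distr_pair_PiM_eq_PiM[of "- {i}" M i] prob by (simp only: U)
  have cong: "PiM (- {i}) (\<lambda>j. M (g j)) = ?R"
    using eq by (intro PiM_cong) auto
  have **: "distr (PiM UNIV M) ?R (\<lambda>w. \<lambda>n\<in>- {i}. w (g n)) = ?R"
    using distr_PiM_reindex[of UNIV M g "- {i}"] prob inj unfolding cong by auto
  have m[measurable]: "(\<lambda>w. \<lambda>n\<in>- {i}. w (g n)) \<in> PiM UNIV M \<rightarrow>\<^sub>M ?R"
    by (intro measurable_restrict) (metis ComplD UNIV_I eq insertI1 measurable_component_singleton)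
  have "(\<integral>\<^sup>+w. F w \<partial>PiM UNIV M) = (\<integral>\<^sup>+z. F ((snd z)(i := fst z)) \<partial>(M i \<Otimes>\<^sub>M ?R))"
    by (subst *[symmetric], subst nn_integral_distr) (auto simp: case_prod_beta')
  also have "\<dots> = (\<integral>\<^sup>+s. \<integral>\<^sup>+X. F (X(i := s)) \<partial>?R \<partial>M i)"
    by (subst R.nn_integral_fst[symmetric]) (auto simp: case_prod_beta')
  also have "\<dots> = (\<integral>\<^sup>+s. \<integral>\<^sup>+w. F (\<lambda>j. if j = i then s else w (g j)) \<partial>PiM UNIV M \<partial>M i)"
  proof (rule nn_integral_cong)
    fix s assume s[measurable]: "s \<in> space (M i)"
    have [measurable]: "(\<lambda>X. X(i := s)) \<in> ?R \<rightarrow>\<^sub>M PiM UNIV M"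
      by (rule measurable_compose[OF measurable_Pair1'[OF s], of "\<lambda>(x, X). X(i := x)", simplified]) measurable
    have e: "(\<lambda>n\<in>- {i}. w (g n))(i := s) = (\<lambda>j. if j = i then s else w (g j))" for w
      by auto
    show "(\<integral>\<^sup>+X. F (X(i := s)) \<partial>?R) = (\<integral>\<^sup>+w. F (\<lambda>j. if j = i then s else w (g j)) \<partial>PiM UNIV M)"
      by (subst **[symmetric], subst nn_integral_distr) (auto simp: e)
  qed
  finally show ?thesis .
qed

instance kind :: finite
proof
  have "(UNIV :: kind set) = {SideA, SideB, Free}" using kind.exhaust by blast
  then show "finite (UNIV :: kind set)" by (metis finite.simps)
qed

instance state :: countable
  by countable_datatype

lemma UNIV_kind: "UNIV = {SideA, SideB, Free}"
  using kind.exhaust by blast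

section \<open>Exponential clocks and their lack of memory\<close>

definition clock :: "real \<Rightarrow> real measure" where
  "clock l = density lborel (\<lambda>t. ennreal (exponential_density l t))"

definition clocks :: "(kind \<Rightarrow> real) \<Rightarrow> (kind \<times> nat \<Rightarrow> real) measure" where
  "clocks lam = PiM UNIV (\<lambda>(k, n). clock (lam k))"

lemma space_clock [simp]: "space (clock l) = UNIV"
  and sets_clock [simp, measurable_cong]: "sets (clock l) = sets borel"
  by (simp_all add: clock_def)

lemma sets_clocks [measurable_cong]: "sets (clocks lam) = sets (PiM UNIV (\<lambda>_. borel))"
  unfolding clocks_def by (intro sets_PiM_cong) auto

lemma space_clocks [simp]: "space (clocks lam) = UNIV"
  by (simp add: clocks_def space_PiM PiE_def extensional_def split_beta)

lemma nn_integral_clock: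
  assumes [measurable]: "f \<in> borel_measurable borel"
  shows "(\<integral>\<^sup>+t. f t \<partial>clock l) = (\<integral>\<^sup>+t. ennreal (exponential_density l t) * f t \<partial>lborel)"
  by (simp add: clock_def nn_integral_density)

text \<open>After the substitution \<open>s = t + u\<close> the density at \<open>t + u\<close> is
  \<open>exp (- l * t)\<close> times the density at \<open>u\<close>, for
  \<open>u \<ge> 0\<close>.\<close>

lemma nn_integral_clock_memoryless:
  assumes [measurable]: "h \<in> borel_measurable borel" and "t \<ge> 0" "l > 0"
  shows "(\<integral>\<^sup>+s. indicator {t<..} s * h (s - t) \<partial>clock l) = ennreal (exp (- l * t)) * (\<integral>\<^sup>+u. h u \<partial>clock l)"
proof -
  have "(\<integral>\<^sup>+s. indicator {t<..} s * h (s - t) \<partial>clock l) =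
    (\<integral>\<^sup>+s. ennreal (exponential_density l s) * (indicator {t<..} s * h (s - t)) \<partial>lborel)"
    by (rule nn_integral_clock) measurable
  also have "\<dots> = (\<integral>\<^sup>+u. ennreal (exponential_density l (t + u)) * (indicator {t<..} (t + u) * h u) \<partial>lborel)"
    by (subst nn_integral_real_affine[where c=1 and t=t]) auto
  also have "\<dots> = (\<integral>\<^sup>+u. ennreal (exp (- l * t)) * (ennreal (exponential_density l u) * h u) \<partial>lborel)"
  proof (rule nn_integral_cong_AE)
    show "AE u in lborel. ennreal (exponential_density l (t + u)) * (indicator {t<..} (t + u) * h u) =
        ennreal (exp (- l * t)) * (ennreal (exponential_density l u) * h u)"
      \<comment> \<open>At \<open>u = 0\<close> the strict indicator vanishes while the density does
        not, so the two integrands agree only off this null set.\<close>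
      using AE_lborel_singleton[of 0]
    proof eventually_elim
      case (elim u)
      show ?case
      proof (cases "u < 0")
        case True
        then show ?thesis by (simp add: exponential_density_def)
      next
        case False
        then have "exponential_density l (t + u) = exp (- l * t) * exponential_density l u"
          using assms by (simp add: exponential_density_def algebra_simps exp_add[symmetric])
        then show ?thesis using False elim assms
          by (simp add: ennreal_mult exponential_density_def mult_ac)
      qed
    qed
  qed
  also have "\<dots> = ennreal (exp (- l * t)) * (\<integral>\<^sup>+u. h u \<partial>clock l)"
    by (simp add: nn_integral_clock nn_integral_cmult)
  finally show ?thesis .
qed

lemma prob_clock: "l > 0 \<Longrightarrow> prob_space (clock l)"
  unfolding clock_def by (rule prob_space_exponential_density)

text \<open>The inequality is strict so that the events for different kinds are disjoint and
  determine the arbitrary choice made by \<open>arg_min\<close>.\<close>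

definition wins :: "kind \<Rightarrow> (kind \<times> nat \<Rightarrow> real) \<Rightarrow> bool" where
  "wins k w \<longleftrightarrow> (\<forall>k'. k' \<noteq> k \<longrightarrow> w (k, 0) < w (k', 0))"

text \<open>The clocks as seen from the moment of an arrival of kind \<open>k\<close>: in every
  other stream the residual time takes the place of the running clock.\<close>

definition shift :: "kind \<Rightarrow> (kind \<times> nat \<Rightarrow> real) \<Rightarrow> kind \<times> nat \<Rightarrow> real" where
  "shift k w = (\<lambda>(k', n). if k' = k then w (k, Suc n)
     else if n = 0 then w (k', 0) - w (k, 0) else w (k', n))"

lemma measurable_wins [measurable]: "Measurable.pred (PiM UNIV (\<lambda>_. borel)) (wins k)"
  unfolding wins_def by measurable

lemma measurable_shift [measurable]: "shift k \<in> PiM UNIV (\<lambda>_. borel) \<rightarrow>\<^sub>M PiM UNIV (\<lambda>_. borel)"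
proof (rule measurable_PiM_single')
  fix i :: "kind \<times> nat"
  show "(\<lambda>w. shift k w i) \<in> borel_measurable (PiM UNIV (\<lambda>_. borel))"
    by (cases i) (simp add: shift_def)
qed (auto simp: space_PiM)

lemma measurable_upd_clocks [measurable]:
  "(\<lambda>(s, w). w(i := s)) \<in> borel \<Otimes>\<^sub>M PiM UNIV (\<lambda>_. borel) \<rightarrow>\<^sub>M PiM UNIV (\<lambda>_. borel)"
proof (rule measurable_PiM_single')
  fix j
  show "(\<lambda>x. (case x of (s, w) \<Rightarrow> w(i := s)) j) \<in> borel \<Otimes>\<^sub>M PiM UNIV (\<lambda>_. borel) \<rightarrow>\<^sub>M borel"
    by (cases "j = i") (auto simp: split_beta)
qed (auto simp: space_PiM)

lemma measurable_upd_clocks' [measurable (raw)]: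
  assumes [measurable]: "f \<in> borel_measurable N" "g \<in> N \<rightarrow>\<^sub>M PiM UNIV (\<lambda>_. borel)"
  shows "(\<lambda>x. (g x)(i := f x)) \<in> N \<rightarrow>\<^sub>M PiM UNIV (\<lambda>_. borel)"
proof -
  have "(\<lambda>x. case (f x, g x) of (s, w) \<Rightarrow> w(i := s)) \<in> N \<rightarrow>\<^sub>M PiM UNIV (\<lambda>_. borel)" by measurable
  then show ?thesis by simp
qed

locale matchmaking =
  fixes lam :: "kind \<Rightarrow> real"
  assumes lam_pos: "lam k > 0"
begin

definition total :: real where "total = (\<Sum>k\<in>UNIV. lam k)"

lemma total_pos: "total > 0"
  unfolding total_def using lam_pos by (intro sum_pos) auto

sublocale clocks: prob_space "clocks lam"
  unfolding clocks_def by (intro prob_space_PiM) (auto intro: prob_clock lam_pos)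

lemma nn_integral_clocks_reindex_upd:
  assumes "inj_on g (- {i})" and "\<And>j. j \<noteq> i \<Longrightarrow> fst (g j) = fst j"
    and "F \<in> borel_measurable (PiM UNIV (\<lambda>_. borel))"
  shows "(\<integral>\<^sup>+w. F w \<partial>clocks lam) =
    (\<integral>\<^sup>+s. \<integral>\<^sup>+w. F (\<lambda>j. if j = i then s else w (g j)) \<partial>clocks lam \<partial>clock (lam (fst i)))"
proof -
  let ?M = "\<lambda>(k, n::nat). clock (lam k)"
  have *: "F \<in> borel_measurable (PiM UNIV ?M)"
    using assms(3) unfolding measurable_cong_sets[OF sets_clocks[of lam, unfolded clocks_def] refl] .
  have "(\<integral>\<^sup>+w. F w \<partial>PiM UNIV ?M) =
    (\<integral>\<^sup>+s. \<integral>\<^sup>+w. F (\<lambda>j. if j = i then s else w (g j)) \<partial>PiM UNIV ?M \<partial>?M i)"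
    using assms(1,2) * by (intro nn_integral_PiM_reindex_upd) (auto simp: split_beta intro: prob_clock lam_pos)
  then show ?thesis by (simp add: clocks_def split_beta)
qed

text \<open>Conditioning one clock on survival leaves the original product law behind, so this can
  be applied to one losing clock after the other.\<close>

lemma nn_integral_memoryless:
  assumes [measurable]: "H \<in> borel_measurable (PiM UNIV (\<lambda>_. borel))" and t: "t \<ge> 0"
  shows "(\<integral>\<^sup>+w. indicator {t<..} (w (k, 0)) * H (w((k, 0) := w (k, 0) - t)) \<partial>clocks lam) =
    ennreal (exp (- lam k * t)) * (\<integral>\<^sup>+w. H w \<partial>clocks lam)"
proof -
  let ?i = "(k, 0::nat)"
  have u: "(\<lambda>j. if j = ?i then s else w (id j)) = w(?i := s)" for w :: "kind \<times> nat \<Rightarrow> real" and s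
    by auto
  note upd = nn_integral_clocks_reindex_upd[of id ?i, unfolded u, simplified]
  have "(\<integral>\<^sup>+w. indicator {t<..} (w ?i) * H (w(?i := w ?i - t)) \<partial>clocks lam) =
    (\<integral>\<^sup>+s. \<integral>\<^sup>+w. indicator {t<..} s * H (w(?i := s - t)) \<partial>clocks lam \<partial>clock (lam k))"
    by (subst upd) auto
  also have "\<dots> = (\<integral>\<^sup>+s. indicator {t<..} s * (\<integral>\<^sup>+w. H (w(?i := s - t)) \<partial>clocks lam) \<partial>clock (lam k))"
    by (subst nn_integral_cmult) auto
  also have "\<dots> = ennreal (exp (- lam k * t)) * (\<integral>\<^sup>+s. (\<integral>\<^sup>+w. H (w(?i := s)) \<partial>clocks lam) \<partial>clock (lam k))"
    by (rule nn_integral_clock_memoryless) (use t lam_pos in auto)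
  also have "\<dots> = ennreal (exp (- lam k * t)) * (\<integral>\<^sup>+w. H w \<partial>clocks lam)"
    by (subst upd) auto
  finally show ?thesis .
qed

text \<open>Fix the winning time \<open>t\<close>. Each loser survives \<open>t\<close> with
  probability \<open>exp (- lam k' * t)\<close> and its residual is a fresh clock. The survival
  factors turn the density of rate \<open>lam k\<close> into \<open>lam k / total\<close> times the
  density of rate \<open>total\<close>, which separates kind, time and future.\<close>

lemma nn_integral_first_arrival_kind:
  assumes F[measurable]: "case_prod F \<in> borel_measurable (borel \<Otimes>\<^sub>M PiM UNIV (\<lambda>_. borel))"
  shows "(\<integral>\<^sup>+w. indicator {w. wins k w} w * F (w (k, 0)) (shift k w) \<partial>clocks lam) =
    ennreal (lam k / total) * (\<integral>\<^sup>+t. \<integral>\<^sup>+w. F t w \<partial>clocks lam \<partial>clock total)"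
proof -
  obtain k1 k2 where k: "k1 \<noteq> k" "k2 \<noteq> k" "k1 \<noteq> k2" "UNIV = {k, k1, k2}"
    by (cases k) (use UNIV_kind in \<open>auto simp: insert_commute\<close>)
  then have tot: "total = lam k + lam k1 + lam k2"
    unfolding total_def k(4) by auto
  have all: "(\<forall>x. P x) \<longleftrightarrow> P k \<and> P k1 \<and> P k2" for P :: "kind \<Rightarrow> bool"
    using k(4) by (metis UNIV_I empty_iff insert_iff)
  have lam0: "lam k > 0" "lam k1 > 0" "lam k2 > 0" by (rule lam_pos)+
  \<comment> \<open>Truncated subtraction sends \<open>(k, 0)\<close> and \<open>(k, 1)\<close> to
    the same index, but injectivity is only required off \<open>(k, 0)\<close>. Thus
    \<open>cons t w\<close> below is \<open>w\<close> with \<open>t\<close> put in front of stream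
    \<open>k\<close>.\<close>
  let ?g = "\<lambda>(k', n). if k' = k then (k', n - Suc 0) else (k', n)"
  have inj: "inj_on ?g (- {(k, 0)})"
    by (auto simp: inj_on_def split: if_splits)
  define cons where "cons t w = (\<lambda>j. if j = (k, 0) then t else w (?g j))" for t :: real and w :: "kind \<times> nat \<Rightarrow> real"
  have wins: "wins k (cons t w) \<longleftrightarrow> t < w (k1, 0) \<and> t < w (k2, 0)" for t w
    using k by (simp add: wins_def cons_def all)
  have shift: "shift k (cons t w) = w((k1, 0) := w (k1, 0) - t, (k2, 0) := w (k2, 0) - t)" for t w
  proof
    fix j show "shift k (cons t w) j = (w((k1, 0) := w (k1, 0) - t, (k2, 0) := w (k2, 0) - t)) j"
      using k k(4)[THEN equalityD1, THEN subsetD, of "fst j"]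
      by (cases j) (auto simp: shift_def cons_def)
  qed
  have nz: "AE t in clock (lam k). t \<ge> 0"
    unfolding clock_def by (subst AE_density) (auto simp: exponential_density_def)
  have "(\<integral>\<^sup>+w. indicator {w. wins k w} w * F (w (k, 0)) (shift k w) \<partial>clocks lam) =
    (\<integral>\<^sup>+t. \<integral>\<^sup>+w. indicator {w. wins k w} (cons t w) * F t (shift k (cons t w)) \<partial>clocks lam \<partial>clock (lam k))"
    by (subst nn_integral_clocks_reindex_upd[OF inj]) (auto simp: cons_def split: if_splits)
  also have "\<dots> = (\<integral>\<^sup>+t. \<integral>\<^sup>+w. indicator {t<..} (w (k1, 0)) * (indicator {t<..} (w (k2, 0)) *
      F t (w((k1, 0) := w (k1, 0) - t, (k2, 0) := w (k2, 0) - t))) \<partial>clocks lam \<partial>clock (lam k))"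
    by (simp add: wins shift indicator_def of_bool_conj mult.assoc)
  also have "\<dots> = (\<integral>\<^sup>+t. ennreal (exp (- lam k1 * t)) * (ennreal (exp (- lam k2 * t)) *
      (\<integral>\<^sup>+w. F t w \<partial>clocks lam)) \<partial>clock (lam k))"
  proof (rule nn_integral_cong_AE)
    show "AE t in clock (lam k). (\<integral>\<^sup>+w. indicator {t<..} (w (k1, 0)) * (indicator {t<..} (w (k2, 0)) *
      F t (w((k1, 0) := w (k1, 0) - t, (k2, 0) := w (k2, 0) - t))) \<partial>clocks lam) =
      ennreal (exp (- lam k1 * t)) * (ennreal (exp (- lam k2 * t)) * (\<integral>\<^sup>+w. F t w \<partial>clocks lam))"
      using nz
    proof eventually_elim
      case (elim t)
      show ?case
        \<comment> \<open>The first instance removes the age of \<open>k1\<close> from an integrand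
          that still contains the test for \<open>k2\<close>; the second instance removes that
          one.\<close>
        using nn_integral_memoryless[of "\<lambda>w. indicator {t<..} (w (k2, 0)) * F t (w((k2, 0) := w (k2, 0) - t))" t k1]
          nn_integral_memoryless[of "F t" t k2] elim k by simp
    qed
  qed
  also have "\<dots> = (\<integral>\<^sup>+t. ennreal (exponential_density (lam k) t) * (ennreal (exp (- lam k1 * t)) * (ennreal (exp (- lam k2 * t)) *
      (\<integral>\<^sup>+w. F t w \<partial>clocks lam))) \<partial>lborel)"
    by (rule nn_integral_clock) measurable
  also have "\<dots> = (\<integral>\<^sup>+t. ennreal (lam k / total) * (ennreal (exponential_density total t) * (\<integral>\<^sup>+w. F t w \<partial>clocks lam)) \<partial>lborel)"
  proof (rule nn_integral_cong)
    fix t :: real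
    have "exponential_density (lam k) t * (exp (- lam k1 * t) * exp (- lam k2 * t)) = lam k / total * exponential_density total t"
    proof -
      have "exp (- t * lam k) * (exp (- lam k1 * t) * exp (- lam k2 * t)) = exp (- t * total)"
        by (simp add: tot algebra_simps flip: exp_add)
      then show ?thesis using total_pos by (simp add: exponential_density_def)
    qed
    moreover have "exponential_density (lam k) t \<ge> 0" "exponential_density total t \<ge> 0"
      using lam0 total_pos by (auto simp: exponential_density_def)
    ultimately show "ennreal (exponential_density (lam k) t) * (ennreal (exp (- lam k1 * t)) * (ennreal (exp (- lam k2 * t)) *
      (\<integral>\<^sup>+w. F t w \<partial>clocks lam))) = ennreal (lam k / total) * (ennreal (exponential_density total t) * (\<integral>\<^sup>+w. F t w \<partial>clocks lam))"
      using lam0 total_pos by (simp add: mult.assoc[symmetric] ennreal_mult[symmetric])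
  qed
  also have "\<dots> = ennreal (lam k / total) * (\<integral>\<^sup>+t. \<integral>\<^sup>+w. F t w \<partial>clocks lam \<partial>clock total)"
    by (subst nn_integral_cmult) (auto simp: nn_integral_clock)
  finally show ?thesis .
qed

end

section \<open>Moving the time origin to the first arrival\<close>

definition first :: "(kind \<times> nat \<Rightarrow> real) \<Rightarrow> kind" where
  "first w = arg_min (\<lambda>k. w (k, 0)) (\<lambda>_. True)"

lemma first_le: "w (first w, 0) \<le> w (k, 0)"
  using arg_min_least[of "UNIV :: kind set" k "\<lambda>k. w (k, 0)"]
  by (simp add: first_def arg_min_on_def)

lemma wins_imp_first: "wins k w \<Longrightarrow> first w = k"
  using first_le[of w k] unfolding wins_def by (metis not_le)

text \<open>\<open>arg_min\<close> is a choice from the set of minimisers. This set depends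
  measurably on \<open>x\<close> as an element of a finite discrete space, and there every function,
  in particular \<open>SOME\<close>, is measurable.\<close>

lemma measurable_arg_min_finite:
  fixes f :: "'a::finite \<Rightarrow> 'b \<Rightarrow> real"
  assumes [measurable]: "\<And>k. f k \<in> borel_measurable N"
  shows "(\<lambda>x. arg_min (\<lambda>k. f k x) (\<lambda>_. True)) \<in> N \<rightarrow>\<^sub>M count_space UNIV"
proof -
  define A where "A x = {k. is_arg_min (\<lambda>k. f k x) (\<lambda>_. True) k}" for x
  have "A \<in> N \<rightarrow>\<^sub>M count_space UNIV"
  proof (subst measurable_count_space_eq2, simp, safe)
    fix B :: "'a set"
    have "A -` {B} \<inter> space N = {x \<in> space N. \<forall>k. (\<forall>y. \<not> f y x < f k x) \<longleftrightarrow> k \<in> B}"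
      by (auto simp: A_def is_arg_min_def set_eq_iff)
    also have "\<dots> \<in> sets N" by measurable
    finally show "A -` {B} \<inter> space N \<in> sets N" .
  qed simp
  then have "(\<lambda>x. (SOME k. k \<in> A x)) \<in> N \<rightarrow>\<^sub>M count_space UNIV"
    by (rule measurable_compose) simp
  then show ?thesis by (simp add: A_def arg_min_def)
qed

lemma measurable_first [measurable]: "first \<in> PiM UNIV (\<lambda>_. borel) \<rightarrow>\<^sub>M count_space UNIV"
  unfolding first_def by (rule measurable_arg_min_finite) measurable

fun step :: "state \<Rightarrow> kind \<Rightarrow> state" where
  "step (Net i) SideA = Net (i + 1)"
| "step (Net i) SideB = Net (i - 1)"
| "step (Net i) Free = (if i > 0 then Net (i - 1) else if i < 0 then Net (i + 1) else Lone_Free)"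
| "step Lone_Free k = Net 0"

text \<open>The state component is carried along so that the map acts on the sample space itself and
  can be iterated.\<close>

definition next_sample :: "sample \<Rightarrow> sample" where
  "next_sample \<omega> = (step (fst \<omega>) (first (snd \<omega>)), shift (first (snd \<omega>)) (snd \<omega>))"

lemma arrival_time_0 [simp]: "arrival_time \<omega> k 0 = snd \<omega> (k, 0)"
  by (simp add: arrival_time_def)

lemma kind_at_0: "kind_at \<omega> 0 = first (snd \<omega>)"
  by (simp add: kind_at_def next_kind_def first_def)

lemma time_at_0: "time_at \<omega> 0 = snd \<omega> (first (snd \<omega>), 0)"
  by (simp add: time_at_def kind_at_0)

text \<open>In the winning stream the first summand is split off; in the others the subtraction made
  by \<open>shift\<close> touches only the first summand. Hence all three streams are translated by
  the same amount.\<close>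

lemma arrival_time_next_sample:
  fixes \<omega> :: sample
  defines "k0 \<equiv> first (snd \<omega>)"
  shows "arrival_time \<omega> k ((c(k0 := Suc (c k0))) k) = snd \<omega> (k0, 0) + arrival_time (next_sample \<omega>) k (c k)"
proof (cases "k = k0")
  case True
  then show ?thesis
    by (simp add: arrival_time_def next_sample_def shift_def k0_def sum.atMost_Suc_shift del: sum.atMost_Suc)
next
  case False
  then show ?thesis
    by (simp add: arrival_time_def next_sample_def shift_def k0_def[symmetric] sum.atMost_shift)
qed

text \<open>A common translation leaves the predicate \<open>is_arg_min\<close> unchanged, so even
  ties are resolved by the same choice, and no almost-sure qualification is necessary.\<close>

lemma next_kind_next_sample:
  fixes \<omega> :: sample
  defines "k0 \<equiv> first (snd \<omega>)"
  shows "next_kind \<omega> (c(k0 := Suc (c k0))) = next_kind (next_sample \<omega>) c"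
  unfolding next_kind_def k0_def arrival_time_next_sample arg_min_def is_arg_min_def by simp

lemma arrived_Suc_next_sample:
  fixes \<omega> :: sample
  defines "k0 \<equiv> first (snd \<omega>)"
  shows "arrived \<omega> (Suc m) = (arrived (next_sample \<omega>) m)(k0 := Suc (arrived (next_sample \<omega>) m k0))"
proof (induction m)
  case 0
  show ?case using kind_at_0[of \<omega>] by (simp add: k0_def kind_at_def)
next
  case (Suc m)
  have "next_kind \<omega> (arrived \<omega> (Suc m)) = next_kind (next_sample \<omega>) (arrived (next_sample \<omega>) m)"
    unfolding Suc k0_def by (rule next_kind_next_sample)
  then have "arrived \<omega> (Suc (Suc m)) = (arrived \<omega> (Suc m))
     (next_kind (next_sample \<omega>) (arrived (next_sample \<omega>) m) :=
       Suc (arrived \<omega> (Suc m) (next_kind (next_sample \<omega>) (arrived (next_sample \<omega>) m))))"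
    by (subst arrived.simps) (simp only: Let_def)
  then show ?case unfolding Suc
    by (auto simp: Let_def fun_eq_iff)
qed

lemma kind_at_Suc: "kind_at \<omega> (Suc m) = kind_at (next_sample \<omega>) m"
  unfolding kind_at_def arrived_Suc_next_sample by (rule next_kind_next_sample)

lemma time_at_Suc: "time_at \<omega> (Suc m) = time_at \<omega> 0 + time_at (next_sample \<omega>) m"
  unfolding time_at_def[of \<omega> "Suc m"] time_at_def[of "next_sample \<omega>"] kind_at_Suc
  unfolding arrived_Suc_next_sample arrival_time_next_sample by (simp add: time_at_0)

lemma kind_at_funpow: "kind_at \<omega> (n + m) = kind_at ((next_sample ^^ n) \<omega>) m"
  by (induction n arbitrary: \<omega>) (simp_all add: kind_at_Suc funpow_Suc_right del: funpow.simps(2))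

lemma time_at_funpow: "time_at \<omega> (Suc (n + m)) - time_at \<omega> n = time_at ((next_sample ^^ Suc n) \<omega>) m"
proof (induction n arbitrary: \<omega>)
  case 0
  then show ?case by (simp add: time_at_Suc)
next
  case (Suc n)
  show ?case using Suc[of "next_sample \<omega>"]
    by (simp add: time_at_Suc[of _ "Suc (n + m)"] time_at_Suc[of _ n] funpow_Suc_right del: funpow.simps(2))
qed

definition nonneg :: "sample \<Rightarrow> bool" where
  "nonneg \<omega> \<longleftrightarrow> (\<forall>j. snd \<omega> j \<ge> 0)"

lemma nonneg_next_sample: "nonneg \<omega> \<Longrightarrow> nonneg (next_sample \<omega>)"
  using first_le[of "snd \<omega>"] by (auto simp: nonneg_def next_sample_def shift_def split_beta)

lemma time_at_nonneg: "nonneg \<omega> \<Longrightarrow> time_at \<omega> m \<ge> 0"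
proof (induction m arbitrary: \<omega>)
  case 0
  then show ?case by (simp add: time_at_0 nonneg_def)
next
  case (Suc m)
  then show ?case using Suc.IH[OF nonneg_next_sample]
    by (simp add: time_at_Suc[of _ m] time_at_0 nonneg_def)
qed

text \<open>Arrivals do not react to the queue. This later permits a dummy state in the sample from
  which a matching time is read.\<close>

lemma
  shows kind_at_snd: "snd \<omega> = snd \<omega>' \<Longrightarrow> kind_at \<omega> m = kind_at \<omega>' m"
    and time_at_snd: "snd \<omega> = snd \<omega>' \<Longrightarrow> time_at \<omega> m = time_at \<omega>' m"
proof -
  assume eq: "snd \<omega> = snd \<omega>'"
  have n: "next_kind \<omega> = next_kind \<omega>'"
    by (simp add: next_kind_def arrival_time_def eq fun_eq_iff)
  have "arrived \<omega> m = arrived \<omega>' m" for m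
    by (induction m) (simp_all add: n)
  then show "kind_at \<omega> m = kind_at \<omega>' m" "time_at \<omega> m = time_at \<omega>' m"
    by (simp_all add: kind_at_def time_at_def n arrival_time_def eq)
qed

section \<open>Measurability of the merged process\<close>

abbreviation sample_algebra :: "sample measure" where
  "sample_algebra \<equiv> count_space UNIV \<Otimes>\<^sub>M PiM UNIV (\<lambda>_. borel)"

lemma measurable_arrival_time [measurable]:
  "(\<lambda>\<omega>. arrival_time \<omega> k n) \<in> borel_measurable sample_algebra"
  unfolding arrival_time_def by measurable

lemma measurable_next_kind [measurable]:
  "(\<lambda>\<omega>. next_kind \<omega> c) \<in> sample_algebra \<rightarrow>\<^sub>M count_space UNIV"
  unfolding next_kind_def by (rule measurable_arg_min_finite) measurable

text \<open>The counts live in the countable type \<open>kind \<Rightarrow> nat\<close>, so that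
  compositions may be checked for one fixed value of the counts at a time.\<close>

lemma measurable_arrived [measurable]:
  "(\<lambda>\<omega>. arrived \<omega> m) \<in> sample_algebra \<rightarrow>\<^sub>M count_space UNIV"
proof (induction m)
  case (Suc m)
  note [measurable] = Suc
  have [measurable]: "(\<lambda>\<omega>. next_kind \<omega> (arrived \<omega> m)) \<in> sample_algebra \<rightarrow>\<^sub>M count_space UNIV"
    by (rule measurable_compose_countable[OF measurable_next_kind Suc])
  show ?case unfolding arrived.simps Let_def
    by (rule measurable_compose_countable[OF _ Suc]) measurable
qed simp

lemma measurable_kind_at [measurable]:
  "(\<lambda>\<omega>. kind_at \<omega> m) \<in> sample_algebra \<rightarrow>\<^sub>M count_space UNIV"
  unfolding kind_at_def by (rule measurable_compose_countable[OF measurable_next_kind measurable_arrived])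

lemma measurable_time_at [measurable]:
  "(\<lambda>\<omega>. time_at \<omega> m) \<in> borel_measurable sample_algebra"
  unfolding time_at_def
proof (rule measurable_compose_countable[OF _ measurable_kind_at])
  fix k
  show "(\<lambda>\<omega>. arrival_time \<omega> k (arrived \<omega> m k)) \<in> borel_measurable sample_algebra"
    by (rule measurable_compose_countable[OF measurable_arrival_time, of "\<lambda>\<omega>. arrived \<omega> m k"])
      (rule measurable_compose[OF measurable_arrived], simp)
qed

lemma measurable_queue [measurable]:
  "(\<lambda>\<omega>. queue \<omega> m) \<in> sample_algebra \<rightarrow>\<^sub>M count_space UNIV"
proof (induction m)
  case (Suc m)
  note [measurable] = Suc
  show ?case unfolding queue.simps
    by (rule measurable_compose_countable[OF _ Suc]) measurable
qed simp

text \<open>Replaces an index set that depends on the sample by a fixed countable one, where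
  measurability of the infimum is available.\<close>

lemma INF_if_top:
  fixes f :: "'a \<Rightarrow> 'b::complete_lattice"
  shows "(INF j. if j \<in> A then f j else \<top>) = (INF j\<in>A. f j)"
proof (rule antisym)
  show "(INF j. if j \<in> A then f j else \<top>) \<le> (INF j\<in>A. f j)"
    by (rule INF_greatest, rule INF_lower2) auto
  show "(INF j\<in>A. f j) \<le> (INF j. if j \<in> A then f j else \<top>)"
    by (rule INF_greatest) (auto intro: INF_lower)
qed

lemma measurable_waiting_time [measurable]:
  "(\<lambda>\<omega>. waiting_time \<omega> m) \<in> borel_measurable sample_algebra"
proof -
  have [measurable]: "Measurable.pred sample_algebra (\<lambda>\<omega>. (kind_at \<omega> m, Some m) \<in> set (queue \<omega> j))" for j
    by (rule measurable_compose_countable[OF _ measurable_queue[of j]])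
      (rule measurable_compose[OF measurable_kind_at], simp)
  have eq: "waiting_time \<omega> m = (INF j. if m \<le> j \<and> (kind_at \<omega> m, Some m) \<notin> set (queue \<omega> (Suc j))
      then ennreal (time_at \<omega> j - time_at \<omega> m) else \<top>)" for \<omega>
    unfolding waiting_time_def by (subst INF_if_top[symmetric]) simp
  show ?thesis unfolding eq by measurable
qed

lemma measurable_shift' [measurable (raw)]:
  assumes [measurable]: "f \<in> N \<rightarrow>\<^sub>M count_space UNIV" "g \<in> N \<rightarrow>\<^sub>M PiM UNIV (\<lambda>_. borel)"
  shows "(\<lambda>x. shift (f x) (g x)) \<in> N \<rightarrow>\<^sub>M PiM UNIV (\<lambda>_. borel)"
  by (rule measurable_compose_countable[OF _ assms(1)]) measurable

lemma measurable_next_sample [measurable]: "next_sample \<in> sample_algebra \<rightarrow>\<^sub>M sample_algebra"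
  unfolding next_sample_def
proof (rule measurable_Pair)
  show "(\<lambda>\<omega>. step (fst \<omega>) (first (snd \<omega>))) \<in> sample_algebra \<rightarrow>\<^sub>M count_space UNIV"
    by (rule measurable_compose_countable[OF _ measurable_fst]) measurable
qed measurable

section \<open>The law of the first arrival\<close>

context matchmaking begin

text \<open>The probabilities of the three strict minima add up to \<open>1\<close>, so ties have probability \<open>0\<close>.\<close>
lemma AE_wins: "AE w in clocks lam. \<exists>k. wins k w"
proof -
  have "{w \<in> space (clocks lam). wins k w} \<in> sets (clocks lam)" for k
    by measurable
  then have [measurable]: "{w. wins k w} \<in> sets (clocks lam)" for k
    by simp
  have e: "emeasure (clocks lam) {w. wins k w} = ennreal (lam k / total)" for k
    using nn_integral_first_arrival_kind[of "\<lambda>_ _. 1" k] clocks.emeasure_space_1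
      prob_space.emeasure_space_1[OF prob_clock[OF total_pos]] nn_integral_indicator[of "{w. wins k w}" "clocks lam"]
    by simp
  have d: "disjoint_family (\<lambda>k. {w. wins k w})"
    by (auto simp: disjoint_family_on_def dest!: wins_imp_first)
  have "emeasure (clocks lam) (\<Union>k\<in>UNIV. {w. wins k w}) = (\<Sum>k\<in>UNIV. ennreal (lam k / total))"
    unfolding e[symmetric] using d by (intro sum_emeasure[symmetric]) auto
  also have "\<dots> = 1"
    using lam_pos total_pos by (simp add: sum_nonneg less_imp_le sum_divide_distrib[symmetric] total_def[symmetric])
  finally have "emeasure (clocks lam) {w. \<exists>k. wins k w} = 1"
    by (simp add: Collect_ex_eq)
  moreover have "{w. \<exists>k. wins k w} \<in> sets (clocks lam)"
    unfolding Collect_ex_eq by measurable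
  ultimately show ?thesis using clocks.AE_I_eq_1[of "\<lambda>w. \<exists>k. wins k w"] by simp
qed

text \<open>Almost surely exactly one of the indicators of \<open>wins\<close> is 1, namely that of
  \<open>first w\<close>, so the integral splits into one term per winner.\<close>

lemma nn_integral_first_arrival:
  assumes [measurable]: "\<And>k. case_prod (F k) \<in> borel_measurable (borel \<Otimes>\<^sub>M PiM UNIV (\<lambda>_. borel))"
  shows "(\<integral>\<^sup>+w. F (first w) (w (first w, 0)) (shift (first w) w) \<partial>clocks lam) =
    (\<Sum>k\<in>UNIV. ennreal (lam k / total) * (\<integral>\<^sup>+t. \<integral>\<^sup>+w. F k t w \<partial>clocks lam \<partial>clock total))"
proof -
  have [measurable (raw)]: "(\<lambda>x. F k (f x) (g x)) \<in> borel_measurable N"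
    if "f \<in> borel_measurable N" "g \<in> N \<rightarrow>\<^sub>M PiM UNIV (\<lambda>_. borel)" for N :: "(kind \<times> nat \<Rightarrow> real) measure" and f g k
    using measurable_compose[OF measurable_Pair[OF that] assms[of k]] by simp
  have "(\<integral>\<^sup>+w. F (first w) (w (first w, 0)) (shift (first w) w) \<partial>clocks lam) =
    (\<integral>\<^sup>+w. (\<Sum>k\<in>UNIV. indicator {w. wins k w} w * F k (w (k, 0)) (shift k w)) \<partial>clocks lam)"
  proof (rule nn_integral_cong_AE)
    show "AE w in clocks lam. F (first w) (w (first w, 0)) (shift (first w) w) =
      (\<Sum>k\<in>UNIV. indicator {w. wins k w} w * F k (w (k, 0)) (shift k w))"
      using AE_wins
    proof eventually_elim
      case (elim w)
      then have "wins k w \<longleftrightarrow> k = first w" for k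
        using wins_imp_first by metis
      then show ?case by (simp add: indicator_def)
    qed
  qed
  also have "\<dots> = (\<Sum>k\<in>UNIV. \<integral>\<^sup>+w. indicator {w. wins k w} w * F k (w (k, 0)) (shift k w) \<partial>clocks lam)"
    by (rule nn_integral_sum) measurable
  finally show ?thesis by (simp add: nn_integral_first_arrival_kind)
qed

lemma AE_nonneg: "AE w in clocks lam. \<forall>j. w j \<ge> 0"
proof -
  have nz: "AE t in clock (lam k). t \<ge> 0" for k
    unfolding clock_def by (subst AE_density) (auto simp: exponential_density_def)
  have "AE w in clocks lam. w j \<ge> 0" for j
    using nz unfolding clocks_def
    by (intro AE_PiM_component) (cases j, auto simp: split_beta intro: prob_clock lam_pos)+
  then show ?thesis by (simp add: AE_all_countable)
qed

end

section \<open>Poisson arrivals see the stationary state\<close>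

text \<open>A finite superset of the states that can jump to \<open>y\<close>:
  \<open>Lone_Free\<close> is listed for every integer state, although it leads only to
  \<open>Net 0\<close>. It makes the balance sums finite.\<close>

definition pred_states :: "state \<Rightarrow> state set" where
  "pred_states y = (case y of Net j \<Rightarrow> {Net (j - 1), Net (j + 1), Lone_Free} | Lone_Free \<Rightarrow> {Net 0})"

lemma finite_pred_states [simp]: "finite (pred_states y)"
  by (simp add: pred_states_def split: state.split)

lemma step_in_pred_states: "x \<in> pred_states (step x k)"
  by (cases "(x, k)" rule: step.cases) (auto simp: pred_states_def)

text \<open>Kinds with the same effect add their rates. No arrival leaves the state unchanged, so
  each contributes its full rate to the outflow, and the outflow is the same from every
  state.\<close>

lemma rate_eq_sum_step: "rate lam x y = (\<Sum>k\<in>UNIV. lam k * of_bool (step x k = y))"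
  by (cases x; cases y) (auto simp: UNIV_kind)

lemma rate_eq_0: "x \<notin> pred_states y \<Longrightarrow> rate lam x y = 0"
  unfolding rate_eq_sum_step using step_in_pred_states[of x] by (auto intro!: sum.neutral)

lemma infsum_eq_sum_support:
  fixes f :: "'a \<Rightarrow> 'b::{topological_comm_monoid_add, t2_space}"
  assumes "finite A" and "\<And>x. x \<notin> A \<Longrightarrow> f x = 0"
  shows "infsum f UNIV = sum f A"
  using assms by (subst infsum_finite[symmetric], simp, intro infsum_cong_neutral) auto

lemma infsum_rate: "(\<Sum>\<^sub>\<infinity>z. rate lam y z) = (\<Sum>k\<in>UNIV. lam k)"
proof -
  have "(\<Sum>\<^sub>\<infinity>z. rate lam y z) = (\<Sum>z\<in>range (step y). rate lam y z)"
    by (rule infsum_eq_sum_support) (auto simp: rate_eq_sum_step intro!: sum.neutral)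
  also have "\<dots> = (\<Sum>k\<in>UNIV. \<Sum>z\<in>range (step y). lam k * of_bool (step y k = z))"
    unfolding rate_eq_sum_step by (rule sum.swap)
  also have "\<dots> = (\<Sum>k\<in>UNIV. lam k)"
    by (intro sum.cong refl) (simp add: of_bool_def if_distrib sum.delta cong: if_cong)
  finally show ?thesis .
qed

lemma stationary_distribution_iff:
  "stationary_distribution lam \<pi> \<longleftrightarrow>
    (\<forall>y. (\<Sum>x\<in>pred_states y. pmf \<pi> x * rate lam x y) = pmf \<pi> y * (\<Sum>k\<in>UNIV. lam k))"
proof -
  have "(\<Sum>\<^sub>\<infinity>x. pmf \<pi> x * rate lam x y) = (\<Sum>x\<in>pred_states y. pmf \<pi> x * rate lam x y)" for y
    by (rule infsum_eq_sum_support) (auto simp: rate_eq_0)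
  then show ?thesis by (simp add: stationary_distribution_def infsum_rate)
qed

context matchmaking begin

definition kind_pmf :: "kind pmf" where
  "kind_pmf = embed_pmf (\<lambda>k. lam k / total)"

lemma pmf_kind_pmf: "pmf kind_pmf k = lam k / total"
  unfolding kind_pmf_def
proof (rule pmf_embed_pmf)
  show "(\<integral>\<^sup>+k. ennreal (lam k / total) \<partial>count_space UNIV) = 1"
    using lam_pos total_pos
    by (simp add: nn_integral_count_space_finite sum_nonneg less_imp_le sum_divide_distrib[symmetric] total_def[symmetric])
qed (use lam_pos total_pos in \<open>simp add: less_imp_le\<close>)

lemma nn_integral_kind_pmf:
  "(\<integral>\<^sup>+k. f k \<partial>kind_pmf) = (\<Sum>k\<in>UNIV. ennreal (lam k / total) * f k)"
  by (subst nn_integral_measure_pmf_support[of UNIV]) (auto simp: pmf_kind_pmf mult.commute)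

text \<open>The total rate out of a state is the same for all states, so that the stationary
  distributions are those of the jump chain.\<close>
lemma stationary_imp_invariant:
  assumes "stationary_distribution lam \<pi>"
  shows "bind_pmf \<pi> (\<lambda>x. map_pmf (step x) kind_pmf) = \<pi>"
proof (rule pmf_eqI)
  fix y
  have pmf_map: "pmf (map_pmf (step x) kind_pmf) y = rate lam x y / total" for x
  proof -
    have "pmf (map_pmf (step x) kind_pmf) y = (\<Sum>k\<in>{k. step x k = y}. lam k / total)"
      by (simp add: pmf_map vimage_def measure_measure_pmf_finite pmf_kind_pmf)
    also have "\<dots> = rate lam x y / total"
      by (simp add: rate_eq_sum_step of_bool_def if_distrib sum.If_cases sum_divide_distrib cong: if_cong)
    finally show ?thesis .
  qed
  have "pmf (bind_pmf \<pi> (\<lambda>x. map_pmf (step x) kind_pmf)) y = (\<integral>x. rate lam x y / total \<partial>\<pi>)"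
    by (simp add: pmf_bind pmf_map)
  also have "\<dots> = (\<Sum>x\<in>pred_states y. rate lam x y / total * pmf \<pi> x)"
    using rate_eq_0[of _ y lam] by (intro integral_measure_pmf_real) auto
  also have "\<dots> = (\<Sum>x\<in>pred_states y. pmf \<pi> x * rate lam x y) / total"
    by (simp add: sum_divide_distrib mult.commute)
  also have "\<dots> = pmf \<pi> y"
    using assms total_pos by (simp add: stationary_distribution_iff total_def[symmetric])
  finally show "pmf (bind_pmf \<pi> (\<lambda>x. map_pmf (step x) kind_pmf)) y = pmf \<pi> y" .
qed

lemma nn_integral_stationary:
  assumes "stationary_distribution lam \<pi>"
  shows "(\<integral>\<^sup>+x. (\<Sum>k\<in>UNIV. ennreal (lam k / total) * f (step x k)) \<partial>\<pi>) = (\<integral>\<^sup>+x. f x \<partial>\<pi>)"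
  by (subst (2) stationary_imp_invariant[OF assms, symmetric]) (simp add: nn_integral_kind_pmf)

section \<open>The system seen from its first arrival\<close>

lemma system_space_eq: "system_space lam \<pi> = measure_pmf \<pi> \<Otimes>\<^sub>M clocks lam"
  by (simp add: system_space_def clocks_def clock_def)

lemma sets_system_space [measurable_cong]: "sets (system_space lam \<pi>) = sets sample_algebra"
  unfolding system_space_eq by (intro sets_pair_measure_cong sets_clocks) simp

lemma space_system_space [simp]: "space (system_space lam \<pi>) = UNIV"
  by (simp add: system_space_eq space_pair_measure)

lemma prob_space_system_space: "prob_space (system_space lam \<pi>)"
proof -
  interpret pair_prob_space "measure_pmf \<pi>" "clocks lam" ..
  show ?thesis unfolding system_space_eq by unfold_locales
qed

lemma nn_integral_system_space:
  assumes [measurable]: "f \<in> borel_measurable sample_algebra"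
  shows "(\<integral>\<^sup>+\<omega>. f \<omega> \<partial>system_space lam \<pi>) = (\<integral>\<^sup>+x. \<integral>\<^sup>+w. f (x, w) \<partial>clocks lam \<partial>\<pi>)"
  using assms unfolding measurable_cong_sets[OF sets_system_space[symmetric, of \<pi>] refl] system_space_eq
  by (simp add: clocks.nn_integral_fst)

lemma nn_integral_system_space_first:
  assumes [measurable]: "\<And>x k. case_prod (F x k) \<in> borel_measurable (borel \<Otimes>\<^sub>M PiM UNIV (\<lambda>_. borel))"
  shows "(\<integral>\<^sup>+\<omega>. F (fst \<omega>) (kind_at \<omega> 0) (time_at \<omega> 0) (snd (next_sample \<omega>)) \<partial>system_space lam \<pi>) =
    (\<integral>\<^sup>+x. (\<Sum>k\<in>UNIV. ennreal (lam k / total) * (\<integral>\<^sup>+t. \<integral>\<^sup>+w. F x k t w \<partial>clocks lam \<partial>clock total)) \<partial>\<pi>)"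
proof -
  have [measurable (raw)]: "(\<lambda>z. F x k (f z) (g z)) \<in> borel_measurable N"
    if "f \<in> borel_measurable N" "g \<in> N \<rightarrow>\<^sub>M PiM UNIV (\<lambda>_. borel)" for N :: "sample measure" and f g x k
    using measurable_compose[OF measurable_Pair[OF that] assms[of x k]] by simp
  \<comment> \<open>The hypothesis gives measurability for fixed state and kind only; since both
    range over countable types, they are then replaced by random values one after the other.\<close>
  have "(\<lambda>\<omega>. F x k (time_at \<omega> 0) (snd (next_sample \<omega>))) \<in> borel_measurable sample_algebra" for x k
    by measurable
  from measurable_compose_countable[OF this measurable_kind_at]
  have "(\<lambda>\<omega>. F x (kind_at \<omega> 0) (time_at \<omega> 0) (snd (next_sample \<omega>))) \<in> borel_measurable sample_algebra" for x .
  from measurable_compose_countable[OF this measurable_fst]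
  have "(\<lambda>\<omega>. F (fst \<omega>) (kind_at \<omega> 0) (time_at \<omega> 0) (snd (next_sample \<omega>))) \<in> borel_measurable sample_algebra" .
  then have "(\<integral>\<^sup>+\<omega>. F (fst \<omega>) (kind_at \<omega> 0) (time_at \<omega> 0) (snd (next_sample \<omega>)) \<partial>system_space lam \<pi>) =
    (\<integral>\<^sup>+x. \<integral>\<^sup>+w. F x (first w) (w (first w, 0)) (shift (first w) w) \<partial>clocks lam \<partial>\<pi>)"
    by (subst nn_integral_system_space) (simp_all add: kind_at_0 time_at_0 next_sample_def)
  then show ?thesis by (simp add: nn_integral_first_arrival)
qed

text \<open>The Markov property at the first arrival: the shifted sample has the law of the original
  one and is independent of the elapsed time. The clocks are covered by the splitting above, the
  state by invariance under the jump chain.\<close>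

lemma nn_integral_next_sample:
  assumes st: "stationary_distribution lam \<pi>"
    and F[measurable]: "case_prod F \<in> borel_measurable (borel \<Otimes>\<^sub>M sample_algebra)"
  shows "(\<integral>\<^sup>+\<omega>. F (time_at \<omega> 0) (next_sample \<omega>) \<partial>system_space lam \<pi>) =
    (\<integral>\<^sup>+t. \<integral>\<^sup>+\<omega>. F t \<omega> \<partial>system_space lam \<pi> \<partial>clock total)"
proof -
  interpret C: prob_space "clock total" by (rule prob_clock[OF total_pos])
  interpret P: pair_sigma_finite "measure_pmf \<pi>" "clock total" ..
  have m[measurable]: "case_prod (\<lambda>t w. F t (x, w)) \<in> borel_measurable (borel \<Otimes>\<^sub>M PiM UNIV (\<lambda>_. borel))" for x
  proof -
    have "(\<lambda>z. (fst z, (x, snd z))) \<in> borel \<Otimes>\<^sub>M PiM UNIV (\<lambda>_. borel) \<rightarrow>\<^sub>M borel \<Otimes>\<^sub>M sample_algebra"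
      by measurable
    from measurable_compose[OF this F] show ?thesis by (simp add: case_prod_beta')
  qed
  have "F (time_at \<omega> 0) (next_sample \<omega>) = F (time_at \<omega> 0) (step (fst \<omega>) (kind_at \<omega> 0), snd (next_sample \<omega>))" for \<omega>
    by (simp add: next_sample_def kind_at_0)
  then have "(\<integral>\<^sup>+\<omega>. F (time_at \<omega> 0) (next_sample \<omega>) \<partial>system_space lam \<pi>) =
    (\<integral>\<^sup>+\<omega>. F (time_at \<omega> 0) (step (fst \<omega>) (kind_at \<omega> 0), snd (next_sample \<omega>)) \<partial>system_space lam \<pi>)"
    by simp
  also have "\<dots> = (\<integral>\<^sup>+x. (\<Sum>k\<in>UNIV. ennreal (lam k / total) * (\<integral>\<^sup>+t. \<integral>\<^sup>+w. F t (step x k, w) \<partial>clocks lam \<partial>clock total)) \<partial>\<pi>)"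
    by (rule nn_integral_system_space_first) measurable
  also have "\<dots> = (\<integral>\<^sup>+x. \<integral>\<^sup>+t. \<integral>\<^sup>+w. F t (x, w) \<partial>clocks lam \<partial>clock total \<partial>\<pi>)"
    by (rule nn_integral_stationary[OF st])
  also have "\<dots> = (\<integral>\<^sup>+t. \<integral>\<^sup>+x. \<integral>\<^sup>+w. F t (x, w) \<partial>clocks lam \<partial>\<pi> \<partial>clock total)"
  proof (rule P.Fubini'[symmetric])
    have "(\<lambda>(x, t). \<integral>\<^sup>+w. F t (x, w) \<partial>clocks lam) \<in> borel_measurable (count_space UNIV \<Otimes>\<^sub>M clock total)"
    \<comment> \<open>With countably many states it suffices to check the section in
      \<open>t\<close> for each state.\<close>
    proof (rule measurable_pair_measure_countable1)
      fix x
      show "(\<lambda>y. case (x, y) of (x, t) \<Rightarrow> \<integral>\<^sup>+w. F t (x, w) \<partial>clocks lam) \<in> borel_measurable (clock total)"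
        unfolding prod.case by measurable
    qed simp
    then show "(\<lambda>(x, t). \<integral>\<^sup>+w. F t (x, w) \<partial>clocks lam) \<in> borel_measurable (measure_pmf \<pi> \<Otimes>\<^sub>M clock total)"
      unfolding measurable_cong_sets[OF sets_pair_measure_cong[OF sets_measure_pmf_count_space refl] refl] .
  qed
  also have "\<dots> = (\<integral>\<^sup>+t. \<integral>\<^sup>+\<omega>. F t \<omega> \<partial>system_space lam \<pi> \<partial>clock total)"
    by (subst nn_integral_system_space) auto
  finally show ?thesis .
qed

text \<open>\<open>arrival_cdf m\<close> is the distribution function of the time of arrival number \<open>m\<close>.\<close>
primrec arrival_cdf :: "nat \<Rightarrow> real \<Rightarrow> ennreal" where
  "arrival_cdf 0 s = (\<integral>\<^sup>+t. indicator {..s} t \<partial>clock total)"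
| "arrival_cdf (Suc m) s = (\<integral>\<^sup>+t. arrival_cdf m (s - t) \<partial>clock total)"

text \<open>Induction on \<open>m\<close> by removing the first arrival: its time \<open>t\<close>
  shortens the horizon from \<open>s\<close> to \<open>s - t\<close>, and the shifted sample is
  again stationary. Therefore \<open>s\<close> must be arbitrary in the induction, whereas the state
  factor is the same at every stage.\<close>

lemma arrivals_see_stationary:
  assumes st: "stationary_distribution lam \<pi>"
    and [measurable]: "\<And>x k. \<Psi> x k \<in> borel_measurable (PiM UNIV (\<lambda>_. borel))"
  shows "(\<integral>\<^sup>+\<omega>. indicator {..s} (time_at \<omega> m) *
      \<Psi> (fst ((next_sample ^^ m) \<omega>)) (kind_at \<omega> m) (snd ((next_sample ^^ Suc m) \<omega>)) \<partial>system_space lam \<pi>) =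
    arrival_cdf m s * (\<integral>\<^sup>+x. (\<Sum>k\<in>UNIV. ennreal (lam k / total) * (\<integral>\<^sup>+w. \<Psi> x k w \<partial>clocks lam)) \<partial>\<pi>)"
proof (induction m arbitrary: s)
  case 0
  have i: "(\<integral>\<^sup>+t. \<integral>\<^sup>+w. indicator {..s} t * \<Psi> x k w \<partial>clocks lam \<partial>clock total) =
      arrival_cdf 0 s * (\<integral>\<^sup>+w. \<Psi> x k w \<partial>clocks lam)" for x k
    by (simp add: nn_integral_cmult nn_integral_multc)
  show ?case
    using nn_integral_system_space_first[of "\<lambda>x k t w. indicator {..s} t * \<Psi> x k w" \<pi>]
    unfolding i
    by (subst nn_integral_cmult[symmetric]) (simp_all add: sum_distrib_left mult_ac del: arrival_cdf.simps)
next
  case (Suc m)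
  have pow[measurable]: "(next_sample ^^ n) \<in> sample_algebra \<rightarrow>\<^sub>M sample_algebra" for n
    by (induction n) (auto intro: measurable_compose[OF _ measurable_next_sample] simp: comp_def)
  have "(\<lambda>\<omega>. \<Psi> x k (snd ((next_sample ^^ Suc m) \<omega>))) \<in> borel_measurable sample_algebra" for x k
    by measurable
  from measurable_compose_countable[OF this measurable_kind_at]
  have "(\<lambda>\<omega>. \<Psi> x (kind_at \<omega> m) (snd ((next_sample ^^ Suc m) \<omega>))) \<in> borel_measurable sample_algebra" for x .
  from measurable_compose_countable[OF this measurable_compose[OF pow measurable_fst]]
  have "(\<lambda>\<omega>. \<Psi> (fst ((next_sample ^^ m) \<omega>)) (kind_at \<omega> m) (snd ((next_sample ^^ Suc m) \<omega>)))
      \<in> borel_measurable sample_algebra" .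
  moreover define V where
    "V = (\<lambda>\<omega>. \<Psi> (fst ((next_sample ^^ m) \<omega>)) (kind_at \<omega> m) (snd ((next_sample ^^ Suc m) \<omega>)))"
  ultimately have [measurable]: "V \<in> borel_measurable sample_algebra" by simp
  define F where "F t \<omega> = indicator {..s} (t + time_at \<omega> m) * V \<omega>" for t \<omega>
  have F_eq: "F t \<omega> = indicator {..s - t} (time_at \<omega> m) *
      \<Psi> (fst ((next_sample ^^ m) \<omega>)) (kind_at \<omega> m) (snd ((next_sample ^^ Suc m) \<omega>))" for t \<omega>
    by (auto simp: F_def V_def indicator_def)
  have [measurable]: "case_prod F \<in> borel_measurable (borel \<Otimes>\<^sub>M sample_algebra)"
    unfolding F_def case_prod_beta' by measurable
  have "indicator {..s} (time_at \<omega> (Suc m)) *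
      \<Psi> (fst ((next_sample ^^ Suc m) \<omega>)) (kind_at \<omega> (Suc m)) (snd ((next_sample ^^ Suc (Suc m)) \<omega>)) =
      F (time_at \<omega> 0) (next_sample \<omega>)" for \<omega>
    by (simp add: F_def V_def time_at_Suc kind_at_Suc funpow_Suc_right indicator_def algebra_simps del: funpow.simps(2))
  then have "(\<integral>\<^sup>+\<omega>. indicator {..s} (time_at \<omega> (Suc m)) *
      \<Psi> (fst ((next_sample ^^ Suc m) \<omega>)) (kind_at \<omega> (Suc m)) (snd ((next_sample ^^ Suc (Suc m)) \<omega>)) \<partial>system_space lam \<pi>) =
      (\<integral>\<^sup>+t. \<integral>\<^sup>+\<omega>. F t \<omega> \<partial>system_space lam \<pi> \<partial>clock total)"
    by (simp only: nn_integral_next_sample[OF st \<open>case_prod F \<in> _\<close>])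
  also have "\<dots> = (\<integral>\<^sup>+t. arrival_cdf m (s - t) * (\<integral>\<^sup>+x. (\<Sum>k\<in>UNIV. ennreal (lam k / total) * (\<integral>\<^sup>+w. \<Psi> x k w \<partial>clocks lam)) \<partial>\<pi>) \<partial>clock total)"
    unfolding F_eq Suc.IH ..
  also have "\<dots> = arrival_cdf (Suc m) s * (\<integral>\<^sup>+x. (\<Sum>k\<in>UNIV. ennreal (lam k / total) * (\<integral>\<^sup>+w. \<Psi> x k w \<partial>clocks lam)) \<partial>\<pi>)"
  proof -
    have [measurable]: "arrival_cdf m \<in> borel_measurable borel" for m
    proof (induction m)
      case 0
      interpret C: prob_space "clock total" by (rule prob_clock[OF total_pos])
      show ?case by (simp add: indicator_def)
    next
      case (Suc m)
      interpret C: prob_space "clock total" by (rule prob_clock[OF total_pos])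
      note [measurable] = Suc
      show ?case by simp
    qed
    show ?thesis by (simp add: nn_integral_multc)
  qed
  finally show ?case .
qed

section \<open>The Palm ratio over a unit window\<close>

text \<open>A Chernoff bound: \<open>indicator {..s} t\<close> is at most
  \<open>exp (s - t)\<close>, and \<open>total / (total + 1)\<close> is the Laplace transform at 1
  of an exponential variable of rate \<open>total\<close>. Each further arrival contributes one such
  factor.\<close>

lemma arrival_cdf_le: "arrival_cdf m s \<le> ennreal (exp s * (total / (total + 1)) ^ Suc m)"
proof (induction m arbitrary: s)
  have e: "(\<integral>\<^sup>+t. ennreal (exp (s - t) * c) \<partial>clock total) = ennreal (exp s * (total / (total + 1)) * c)" if "c \<ge> 0" for s c
  proof -
    have "(\<integral>\<^sup>+t. ennreal (exp (s - t) * c) \<partial>clock total) =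
      (\<integral>\<^sup>+t. ennreal (exponential_density total t) * ennreal (exp (s - t) * c) \<partial>lborel)"
      by (rule nn_integral_clock) measurable
    also have "\<dots> = (\<integral>\<^sup>+t. ennreal (exp s * (total / (total + 1)) * c) * ennreal (exponential_density (total + 1) t) \<partial>lborel)"
      using total_pos that
      by (intro nn_integral_cong)
        (auto simp: exponential_density_def ennreal_mult[symmetric] field_simps simp flip: exp_add)
    also have "\<dots> = ennreal (exp s * (total / (total + 1)) * c)"
      using prob_space.emeasure_space_1[OF prob_clock[of "total + 1"]] total_pos
      by (simp add: nn_integral_cmult clock_def emeasure_density)
    finally show ?thesis .
  qed
  case 0
  have "arrival_cdf 0 s \<le> (\<integral>\<^sup>+t. ennreal (exp (s - t) * 1) \<partial>clock total)"
    unfolding arrival_cdf.simps by (intro nn_integral_mono) (auto simp: indicator_def)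
  also have "\<dots> = ennreal (exp s * (total / (total + 1)) * 1)" by (rule e) simp
  finally show ?case by simp
  case (Suc m)
  have "arrival_cdf (Suc m) s \<le> (\<integral>\<^sup>+t. ennreal (exp (s - t) * (total / (total + 1)) ^ Suc m) \<partial>clock total)"
    unfolding arrival_cdf.simps by (intro nn_integral_mono Suc)
  also have "\<dots> = ennreal (exp s * (total / (total + 1)) * (total / (total + 1)) ^ Suc m)"
    using total_pos by (intro e) simp
  finally show ?case by (simp only: mult.assoc power_Suc)
qed

text \<open>The sum is the expected number of arrivals up to time 1.\<close>

lemma suminf_arrival_cdf: "0 < (\<Sum>m. arrival_cdf m 1)" "(\<Sum>m. arrival_cdf m 1) < \<infinity>"
proof -
  have "arrival_cdf 0 1 = (\<integral>\<^sup>+t. ennreal (exponential_density total t) * indicator {..1} t \<partial>lborel)"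
    unfolding arrival_cdf.simps by (rule nn_integral_clock) measurable
  also have "\<dots> = ennreal (1 - exp (- total))"
    using nn_integral_erlang_density[OF total_pos, of 0 1] total_pos by (simp add: erlang_CDF_def)
  finally have "arrival_cdf 0 1 = ennreal (1 - exp (- total))" .
  then have "0 < arrival_cdf 0 1" using total_pos by simp
  also have "arrival_cdf 0 1 \<le> (\<Sum>m. arrival_cdf m 1)"
    using sum_le_suminf[of "\<lambda>m. arrival_cdf m 1" "{0}"] by simp
  finally show "0 < (\<Sum>m. arrival_cdf m 1)" .
  have "(\<Sum>m. arrival_cdf m 1) \<le> (\<Sum>m. ennreal (exp 1 * (total / (total + 1)) ^ Suc m))"
    by (intro suminf_le arrival_cdf_le) auto
  also have "\<dots> < \<infinity>"
    using total_pos unfolding infinity_ennreal_def less_top[symmetric]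
    by (intro ennreal_suminf_neq_top summable_mult summable_Suc_iff[THEN iffD2] summable_geometric) auto
  finally show "(\<Sum>m. arrival_cdf m 1) < \<infinity>" .
qed

text \<open>The hypothesis on \<open>W\<close> puts the waiting time into the form in which state,
  kind and future separate from the arrival time. The integral over the window and the mass of the
  window then share the factor \<open>\<Sum>m. arrival_cdf m 1\<close>.\<close>

lemma mean_waiting_time_eq:
  assumes st: "stationary_distribution lam \<pi>"
    and [measurable]: "\<And>x k. W x k \<in> borel_measurable (PiM UNIV (\<lambda>_. borel))"
    and W: "\<And>\<omega> m. waiting_time \<omega> m =
      W (fst ((next_sample ^^ m) \<omega>)) (kind_at \<omega> m) (snd ((next_sample ^^ Suc m) \<omega>))"
  shows "mean_waiting_time lam \<pi> K =
    (\<integral>\<^sup>+x. (\<Sum>k\<in>K. ennreal (lam k) * (\<integral>\<^sup>+w. W x k w \<partial>clocks lam)) \<partial>\<pi>) / ennreal (\<Sum>k\<in>K. lam k)"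
proof -
  let ?S = "system_space lam \<pi>"
  let ?A = "{(\<omega>, m). kind_at \<omega> m \<in> K \<and> time_at \<omega> m \<le> 1}"
  interpret S: prob_space ?S by (rule prob_space_system_space)
  interpret N: sigma_finite_measure "count_space (UNIV :: nat set)"
    by (rule sigma_finite_measure_count_space_countable) simp
  interpret P: pair_sigma_finite ?S "count_space (UNIV :: nat set)" ..
  have nat_measurable: "case_prod f \<in> borel_measurable (?S \<Otimes>\<^sub>M count_space (UNIV :: nat set))"
    if [measurable]: "\<And>m. (\<lambda>\<omega>. f \<omega> m) \<in> borel_measurable sample_algebra" for f :: "sample \<Rightarrow> nat \<Rightarrow> ennreal"
    using measurable_compose_countable[of "\<lambda>m z. f (fst z) m" "?S \<Otimes>\<^sub>M count_space UNIV" borel snd]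
    by (simp add: case_prod_beta')
  have split: "(\<integral>\<^sup>+z. f z \<partial>(?S \<Otimes>\<^sub>M count_space UNIV)) = (\<Sum>m. \<integral>\<^sup>+\<omega>. f (\<omega>, m) \<partial>?S)"
    if "f \<in> borel_measurable (?S \<Otimes>\<^sub>M count_space (UNIV :: nat set))" for f
    using P.nn_integral_snd[OF that] by (simp add: nn_integral_count_space_nat)
  have "(\<lambda>(\<omega>, m). indicator K (kind_at \<omega> m) * indicator {..1} (time_at \<omega> m) :: ennreal) \<in> borel_measurable (?S \<Otimes>\<^sub>M count_space (UNIV :: nat set))" (is "?I \<in> _")
    by (rule nat_measurable) measurable
  then have "?I -` {1} \<inter> space (?S \<Otimes>\<^sub>M count_space UNIV) \<in> sets (?S \<Otimes>\<^sub>M count_space UNIV)"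
    by measurable
  also have "?I -` {1} \<inter> space (?S \<Otimes>\<^sub>M count_space UNIV) = ?A"
    by (auto simp: space_pair_measure indicator_def simp flip: of_bool_conj)
  finally have A[measurable]: "?A \<in> sets (?S \<Otimes>\<^sub>M count_space UNIV)" .
  have wm[measurable]: "(\<lambda>(\<omega>, m). waiting_time \<omega> m) \<in> borel_measurable (?S \<Otimes>\<^sub>M count_space UNIV)"
    by (rule nat_measurable) measurable
  define C where "C V = (\<integral>\<^sup>+x. (\<Sum>k\<in>UNIV. ennreal (lam k / total) * (\<integral>\<^sup>+w. indicator K k * V x k w \<partial>clocks lam)) \<partial>\<pi>)"
    for V :: "state \<Rightarrow> kind \<Rightarrow> (kind \<times> nat \<Rightarrow> real) \<Rightarrow> ennreal"
  have main: "(\<Sum>m. \<integral>\<^sup>+\<omega>. indicator ?A (\<omega>, m) * V (fst ((next_sample ^^ m) \<omega>)) (kind_at \<omega> m) (snd ((next_sample ^^ Suc m) \<omega>)) \<partial>?S)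
      = (\<Sum>m. arrival_cdf m 1) * C V"
    if [measurable]: "\<And>x k. V x k \<in> borel_measurable (PiM UNIV (\<lambda>_. borel))" for V
  proof -
    have "(\<integral>\<^sup>+\<omega>. indicator ?A (\<omega>, m) * V (fst ((next_sample ^^ m) \<omega>)) (kind_at \<omega> m) (snd ((next_sample ^^ Suc m) \<omega>)) \<partial>?S)
      = arrival_cdf m 1 * C V" for m
      unfolding C_def
      by (subst arrivals_see_stationary[OF st, of "\<lambda>x k w. indicator K k * V x k w", symmetric])
        (auto intro!: nn_integral_cong simp: indicator_def)
    then show ?thesis by (simp add: ennreal_suminf_multc)
  qed
  have C: "C V = (\<integral>\<^sup>+x. (\<Sum>k\<in>K. ennreal (lam k) * (\<integral>\<^sup>+w. V x k w \<partial>clocks lam)) \<partial>\<pi>) / ennreal total"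
    if [measurable]: "\<And>x k. V x k \<in> borel_measurable (PiM UNIV (\<lambda>_. borel))" for V
  proof -
    have "(\<Sum>k\<in>UNIV. ennreal (lam k / total) * (\<integral>\<^sup>+w. indicator K k * V x k w \<partial>clocks lam)) =
      (\<Sum>k\<in>K. ennreal (lam k) * (\<integral>\<^sup>+w. V x k w \<partial>clocks lam)) / ennreal total" for x
    proof -
      have "(\<Sum>k\<in>UNIV. ennreal (lam k / total) * (\<integral>\<^sup>+w. indicator K k * V x k w \<partial>clocks lam)) =
        (\<Sum>k\<in>UNIV. if k \<in> K then ennreal (lam k) * (\<integral>\<^sup>+w. V x k w \<partial>clocks lam) / ennreal total else 0)"
        using lam_pos total_pos
        by (intro sum.cong) (auto simp: divide_ennreal[symmetric] less_imp_le divide_ennreal_def mult_ac)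
      also have "\<dots> = (\<Sum>k\<in>K. ennreal (lam k) * (\<integral>\<^sup>+w. V x k w \<partial>clocks lam) / ennreal total)"
        by (simp add: sum.If_cases)
      finally show ?thesis by (simp add: divide_ennreal_def sum_distrib_right)
    qed
    then show ?thesis unfolding C_def by (simp add: divide_ennreal_def nn_integral_multc)
  qed
  have num: "(\<integral>\<^sup>+z. (case z of (\<omega>, m) \<Rightarrow> waiting_time \<omega> m) * indicator ?A z \<partial>(?S \<Otimes>\<^sub>M count_space UNIV)) =
      (\<Sum>m. arrival_cdf m 1) * C W"
    using main[of W] by (subst split) (simp_all add: W mult.commute[of _ "indicator _ _"] del: funpow.simps)
  have "emeasure (?S \<Otimes>\<^sub>M count_space UNIV) ?A = (\<integral>\<^sup>+z. indicator ?A z \<partial>(?S \<Otimes>\<^sub>M count_space UNIV))"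
    by simp
  \<comment> \<open>The mass of the window is the same computation with the constant 1 in place of
    the waiting time.\<close>
  also have "\<dots> = (\<Sum>m. arrival_cdf m 1) * C (\<lambda>_ _ _. 1)"
    using main[of "\<lambda>_ _ _. 1"] by (subst split) simp_all
  also have "C (\<lambda>_ _ _. 1) = ennreal (\<Sum>k\<in>K. lam k) / ennreal total"
    using lam_pos by (subst C) (simp_all add: clocks.emeasure_space_1[simplified] less_imp_le)
  finally have den: "emeasure (?S \<Otimes>\<^sub>M count_space UNIV) ?A = (\<Sum>m. arrival_cdf m 1) * (ennreal (\<Sum>k\<in>K. lam k) / ennreal total)" .
  \<comment> \<open>The cancelled factor is \<open>u / y\<close>. Nothing is asked of
    \<open>x\<close> and \<open>z\<close>, so an infinite mean and an empty \<open>K\<close> need no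
    separate treatment.\<close>
  have cancel: "(u * (x / y)) / (u * (z / y)) = x / z" if "0 < u" "u < \<infinity>" "0 < y" "y < \<infinity>" for u x y z :: ennreal
  proof -
    have "u * (x / y) / (u * (z / y)) = x * (u / y) / (z * (u / y))"
      by (simp add: ennreal_times_divide mult.commute)
    also have "\<dots> = x / z"
      using that by (intro divide_mult_eq) (auto simp: ennreal_divide_eq_top_iff)
    finally show ?thesis .
  qed
  show ?thesis
    unfolding mean_waiting_time_def typical_player_def
    by (subst nn_integral_uniform_measure) (use suminf_arrival_cdf total_pos in \<open>simp_all add: num den C cancel\<close>)
qed

end

section \<open>Waiting times\<close>

definition opposes :: "kind \<Rightarrow> kind \<Rightarrow> bool" where
  "opposes k k' \<longleftrightarrow> k \<noteq> k' \<or> k = Free"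

lemma can_oppose_iff: "can_oppose p q \<longleftrightarrow> opposes (fst q) (fst p)"
  by (auto simp: can_oppose_def opposes_def)

definition opposers :: "kind \<Rightarrow> sample \<Rightarrow> nat \<Rightarrow> nat" where
  "opposers k \<omega> n = (\<Sum>l<n. of_bool (opposes k (kind_at \<omega> l)))"

lemma opposers_0 [simp]: "opposers k \<omega> 0 = 0"
  by (simp add: opposers_def)

lemma opposers_Suc: "opposers k \<omega> (Suc n) = opposers k \<omega> n + of_bool (opposes k (kind_at \<omega> n))"
  by (simp add: opposers_def)

lemma opposers_Suc_next_sample:
  "opposers k \<omega> (Suc n) = of_bool (opposes k (kind_at \<omega> 0)) + opposers k (next_sample \<omega>) n"
  unfolding opposers_def sum.lessThan_Suc_shift kind_at_Suc ..

text \<open>\<open>match_time k i \<omega>\<close> is the time at which a player of kind \<open>k\<close> with \<open>i\<close> players ahead is matched.\<close>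
definition match_time :: "kind \<Rightarrow> nat \<Rightarrow> sample \<Rightarrow> ennreal" where
  "match_time k i \<omega> = (INF n \<in> {n. i < opposers k \<omega> (Suc n)}. ennreal (time_at \<omega> n))"

lemma match_time_snd: "snd \<omega> = snd \<omega>' \<Longrightarrow> match_time k i \<omega> = match_time k i \<omega>'"
  using kind_at_snd[of \<omega> \<omega>'] time_at_snd[of \<omega> \<omega>'] by (simp add: match_time_def opposers_def)

lemma measurable_match_time [measurable]: "match_time k i \<in> borel_measurable sample_algebra"
proof -
  have [measurable]: "(\<lambda>\<omega>. opposers k \<omega> n) \<in> sample_algebra \<rightarrow>\<^sub>M count_space UNIV" for n
    unfolding opposers_def by measurable
  have eq: "match_time k i \<omega> = (INF n. if i < opposers k \<omega> (Suc n) then ennreal (time_at \<omega> n) else \<top>)" for \<omega>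
    unfolding match_time_def by (subst INF_if_top[symmetric]) simp
  show ?thesis unfolding eq by measurable
qed

text \<open>Adding a finite constant is monotone and continuous. For an empty index set, the case of
  a player never matched, both sides are \<infinity>.\<close>

lemma ennreal_add_INF:
  fixes f :: "'a \<Rightarrow> ennreal"
  shows "ennreal t + (INF n\<in>A. f n) = (INF n\<in>A. ennreal t + f n)"
proof (cases "A = {}")
  case False
  have "continuous_on UNIV (\<lambda>x::ennreal. ennreal t + x)"
    by (intro continuous_intros)
  then have "continuous (at_right (Inf (f ` A))) (\<lambda>x::ennreal. ennreal t + x)"
    by (simp add: continuous_on_eq_continuous_at continuous_at_imp_continuous_at_within)
  then have "ennreal t + Inf (f ` A) = (INF x\<in>f ` A. ennreal t + x)"
    using False by (intro continuous_at_Inf_mono) (auto intro!: monoI add_left_mono)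
  then show ?thesis by (simp add: image_comp comp_def)
qed simp

text \<open>First-step analysis on the path: an opposing first arrival removes one player ahead, or
  matches the player itself if \<open>i = 0\<close>; any other leaves \<open>i\<close> as it is.
  Nonnegative times are assumed because \<open>ennreal\<close> would truncate negative ones.\<close>

lemma match_time_rec:
  assumes "nonneg \<omega>"
  shows "match_time k i \<omega> = ennreal (time_at \<omega> 0) +
    (if opposes k (kind_at \<omega> 0) then (case i of 0 \<Rightarrow> 0 | Suc j \<Rightarrow> match_time k j (next_sample \<omega>))
     else match_time k i (next_sample \<omega>))"
proof -
  note nn = time_at_nonneg[OF assms] time_at_nonneg[OF nonneg_next_sample[OF assms]]
  have *: "match_time k i \<omega> = ennreal (time_at \<omega> 0) + match_time k j (next_sample \<omega>)"
    if "\<And>n. i < opposers k \<omega> (Suc n) \<longleftrightarrow> j < opposers k (next_sample \<omega>) n" for j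
  proof -
    \<comment> \<open>No opposer has been counted before the first arrival, so index 0 does not
      qualify and the index set is an image under \<open>Suc\<close>.\<close>
    have "{n. i < opposers k \<omega> (Suc n)} = Suc ` {n. j < opposers k (next_sample \<omega>) (Suc n)}"
      unfolding that by (auto simp: image_iff gr0_conv_Suc intro: gr0I) (metis gr0_conv_Suc neq0_conv not_less0 opposers_0)
    then show ?thesis
      using nn by (simp add: match_time_def image_comp time_at_Suc ennreal_add_INF)
  qed
  show ?thesis
  proof (cases "opposes k (kind_at \<omega> 0)")
    case False
    then show ?thesis by (subst *[of i]) (simp_all add: opposers_Suc_next_sample)
  next
    case True
    show ?thesis
    proof (cases i)
      case (Suc j)
      with True show ?thesis by (subst *[of j]) (simp_all add: opposers_Suc_next_sample)
    next
      case 0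
      \<comment> \<open>Here index 0 qualifies, and no later arrival time is smaller.\<close>
      have "match_time k i \<omega> = ennreal (time_at \<omega> 0)"
        unfolding match_time_def
      proof (rule antisym)
        show "(INF n \<in> {n. i < opposers k \<omega> (Suc n)}. ennreal (time_at \<omega> n)) \<le> ennreal (time_at \<omega> 0)"
          using True 0 by (intro INF_lower) (simp add: opposers_Suc)
        have "time_at \<omega> 0 \<le> time_at \<omega> n" for n
          using nn by (cases n) (simp_all add: time_at_Suc)
        then show "ennreal (time_at \<omega> 0) \<le> (INF n \<in> {n. i < opposers k \<omega> (Suc n)}. ennreal (time_at \<omega> n))"
          by (intro INF_greatest ennreal_leI)
      qed
      then show ?thesis using True 0 by simp
    qed
  qed
qed

section \<open>From the queue of players to the state chain\<close>

text \<open>The number of players whom a player of kind \<open>k\<close> arriving in state \<open>x\<close> finds ahead, and \<open>None\<close> if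
  this player is matched at once.\<close>
fun ahead :: "state \<Rightarrow> kind \<Rightarrow> nat option" where
  "ahead (Net i) SideA = (if i \<ge> 0 then Some (nat i) else None)"
| "ahead (Net i) SideB = (if i \<le> 0 then Some (nat (- i)) else None)"
| "ahead (Net i) Free = (if i = 0 then Some 0 else None)"
| "ahead Lone_Free k = None"

text \<open>A free player is opposed to everybody, hence joins only an empty queue.\<close>

lemma ahead_Some: "ahead x k = Some i \<Longrightarrow> map fst (initial_queue x) = replicate i k \<and> (k = Free \<longrightarrow> i = 0)"
  by (cases "(x, k)" rule: ahead.cases) (auto split: if_splits)

lemma ahead_None:
  assumes "ahead x k = None"
  obtains k' ks where "map fst (initial_queue x) = k' # ks" "opposes k' k"
proof -
  have *: "\<exists>ks. replicate (nat i) a = a # ks" if "i > 0" for i and a :: kind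
    using that by (cases "nat i") auto
  show ?thesis using assms that *
    by (cases "(x, k)" rule: ahead.cases) (force simp: opposes_def split: if_splits)+
qed

text \<open>\<open>arrive\<close> decides by kinds alone, so the identity of the players does not
  affect how the kinds evolve.\<close>

lemma map_fst_arrive:
  "map fst q = map fst q' \<Longrightarrow> fst p = fst p' \<Longrightarrow> map fst (arrive p q) = map fst (arrive p' q')"
proof (induction p q arbitrary: q' rule: arrive.induct)
  case (2 p x q)
  then obtain y r where "q' = y # r" "fst x = fst y" "map fst q = map fst r" by auto
  with 2 show ?case by (simp add: can_oppose_iff)
qed simp

lemma set_arrive: "set (arrive p q) \<subseteq> insert p (set q)"
  by (induction p q rule: arrive.induct) auto

lemma arrive_append: "(\<And>x. x \<in> set q \<Longrightarrow> \<not> can_oppose p x) \<Longrightarrow> arrive p q = q @ [p]"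
  by (induction p q rule: arrive.induct) auto

lemma map_fst_arrive_initial:
  "map fst (arrive (k, t) (initial_queue x)) = map fst (initial_queue (step x k))"
proof -
  \<comment> \<open>In a queue of a single kind the newcomer either takes away the head or is
    appended at the end.\<close>
  have r: "arrive (k, t) (replicate n (k', t')) =
     (if n = 0 \<or> \<not> opposes k' k then replicate n (k', t') @ [(k, t)] else replicate (n - 1) (k', t'))" for n k k' t'
    by (cases n) (auto simp: can_oppose_iff intro!: arrive_append)
  have pos: "initial_queue (Net (int n)) = replicate n (SideA, None)"
    and neg: "initial_queue (Net (- int n)) = replicate n (SideB, None)" for n
    by auto
  have zero: "initial_queue (Net 0) = []"
    by simp
  have step: "step (Net (int (Suc n))) SideA = Net (int (Suc (Suc n)))"
    "step (Net (int (Suc n))) SideB = Net (int n)" "step (Net (int (Suc n))) Free = Net (int n)"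
    "step (Net 0) SideA = Net (int (Suc 0))" "step (Net 0) SideB = Net (- int (Suc 0))" "step (Net 0) Free = Lone_Free"
    "step (Net (- int (Suc n))) SideA = Net (- int n)" "step (Net (- int (Suc n))) Free = Net (- int n)"
    "step (Net (- int (Suc n))) SideB = Net (- int (Suc (Suc n)))" for n
    by auto
  consider "x = Net 0" | n where "x = Net (int (Suc n))" | n where "x = Net (- int (Suc n))" | "x = Lone_Free"
  proof (cases x)
    case (Net i)
    then show thesis using that by (cases i rule: int_cases3) (auto simp: gr0_conv_Suc)
  qed
  then show ?thesis
  proof cases
    case 1
    then show ?thesis by (cases k; simp only: 1 step pos neg; simp)
  next
    case (2 n)
    then show ?thesis by (cases k; simp only: 2 step pos r; simp add: opposes_def replicate_append_same)
  next
    case (3 n)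
    then show ?thesis by (cases k; simp only: 3 step neg r; simp add: opposes_def replicate_append_same)
  qed (simp add: can_oppose_def)
qed

lemma map_fst_queue: "map fst (queue \<omega> m) = map fst (initial_queue (fst ((next_sample ^^ m) \<omega>)))"
proof (induction m)
  case (Suc m)
  have "fst (next_sample ((next_sample ^^ m) \<omega>)) = step (fst ((next_sample ^^ m) \<omega>)) (kind_at \<omega> m)"
    using kind_at_funpow[of \<omega> m 0] by (simp add: next_sample_def kind_at_0)
  then show ?case
    using map_fst_arrive[OF Suc, of "(kind_at \<omega> m, Some m)" "(kind_at \<omega> m, Some m)"]
    by (simp add: map_fst_arrive_initial)
qed simp

text \<open>The tag of a newcomer is fresh, so membership in later queues tracks this very
  player.\<close>

lemma queue_tags: "(k, Some j) \<in> set (queue \<omega> m) \<Longrightarrow> j < m"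
proof (induction m)
  case 0
  then show ?case by (cases "fst \<omega>") (auto split: if_splits)
next
  case (Suc m)
  then show ?case using set_arrive[of "(kind_at \<omega> m, Some m)" "queue \<omega> m"] by fastforce
qed

text \<open>Invariant after \<open>n\<close> further arrivals: the \<open>c n\<close> opposing ones
  have removed the oldest \<open>c n\<close> players ahead, the others have lined up behind, and all
  who wait are of the kind of \<open>p\<close>. Opposing arrival number \<open>i + 1\<close> takes
  \<open>p\<close>, whose tag never returns.\<close>

lemma queue_after_joining:
  fixes \<omega> :: sample and m :: nat
  defines "p \<equiv> (kind_at \<omega> m, Some m)" and "c \<equiv> opposers (kind_at \<omega> m) ((next_sample ^^ Suc m) \<omega>)"
  assumes join: "ahead (fst ((next_sample ^^ m) \<omega>)) (kind_at \<omega> m) = Some i"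
  shows "if c n \<le> i
    then \<exists>r. queue \<omega> (Suc m + n) = drop (c n) (queue \<omega> m) @ p # r \<and> (\<forall>x\<in>set r. fst x = kind_at \<omega> m \<and> snd x \<noteq> Some m)
    else p \<notin> set (queue \<omega> (Suc m + n))"
proof (induction n)
  have kinds: "map fst (queue \<omega> m) = replicate i (kind_at \<omega> m)" and free: "kind_at \<omega> m = Free \<Longrightarrow> i = 0"
    using ahead_Some[OF join] by (auto simp: map_fst_queue)
  then have fst_eq: "x \<in> set (queue \<omega> m) \<Longrightarrow> fst x = kind_at \<omega> m" for x
    by (metis in_set_replicate list.set_map image_eqI)
  have len: "length (queue \<omega> m) = i" using arg_cong[OF kinds, of length] by simp
  {
    case 0
    \<comment> \<open>Two players of the same kind can oppose each other only if free, and then the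
      queue is empty because \<open>i = 0\<close>.\<close>
    have "queue \<omega> (Suc m) = queue \<omega> m @ [p]"
      unfolding queue.simps p_def
      by (rule arrive_append) (use fst_eq free len in \<open>force simp: can_oppose_def\<close>)
    then show ?case by (simp add: c_def)
  next
    case (Suc n)
    let ?k = "kind_at \<omega> (Suc m + n)" and ?q = "queue \<omega> (Suc m + n)"
    let ?p = "(?k, Some (Suc m + n))"
    have q: "queue \<omega> (Suc m + Suc n) = arrive ?p ?q" by simp
    have c: "c (Suc n) = c n + of_bool (opposes (kind_at \<omega> m) ?k)"
      unfolding c_def opposers_Suc by (simp only: kind_at_funpow)
    show ?case
    proof (cases "c n \<le> i")
      case False
      then have "p \<notin> set ?q" using Suc by simp
      moreover have "p \<noteq> ?p" by (simp add: p_def)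
      ultimately have "p \<notin> set (arrive ?p ?q)" using set_arrive by fastforce
      then show ?thesis using False c q by simp
    next
      case True
      then obtain r where r: "?q = drop (c n) (queue \<omega> m) @ p # r"
        "\<forall>x\<in>set r. fst x = kind_at \<omega> m \<and> snd x \<noteq> Some m"
        using Suc by auto
      have all: "fst x = kind_at \<omega> m" if "x \<in> set ?q" for x
      proof -
        have "x \<in> set (drop (c n) (queue \<omega> m)) \<or> x = p \<or> x \<in> set r" using that unfolding r(1) by auto
        then show ?thesis using fst_eq[OF in_set_dropD] r(2) by (metis fst_conv p_def)
      qed
      show ?thesis
      proof (cases "opposes (kind_at \<omega> m) ?k")
        case False
        then have "arrive ?p ?q = ?q @ [?p]"
          using all by (intro arrive_append) (simp add: can_oppose_iff)
        moreover have "?k = kind_at \<omega> m" using False by (simp add: opposes_def)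
        ultimately show ?thesis using True False c r unfolding q by auto
      next
        case opp: True
        have "?q \<noteq> []" using r by simp
        then obtain x xs where x: "?q = x # xs" by (cases ?q) auto
        then have tl: "arrive ?p ?q = tl ?q"
          using all[of x] opp by (simp add: can_oppose_iff)
        show ?thesis
        proof (cases "c n < i")
          case True
          then have "tl (drop (c n) (queue \<omega> m) @ p # r) = drop (Suc (c n)) (queue \<omega> m) @ p # r"
            using len by (subst tl_append2) (simp_all add: drop_Suc tl_drop)
          then show ?thesis using True c opp r unfolding q tl by auto
        next
          case False
          \<comment> \<open>Nobody is left ahead, so \<open>p\<close> is the head that the opposing
            arrival removes.\<close>
          then have "c n = i" using \<open>c n \<le> i\<close> by simp
          moreover have "p \<notin> set r" using r by (auto simp: p_def)
          ultimately show ?thesis using c opp r len unfolding q tl by simp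
        qed
      qed
    qed
  }
qed

text \<open>\<open>Lone_Free\<close> is a dummy: \<open>match_time\<close> reads only the clocks.
  The definition exhibits the waiting time as a function of state, kind and future clocks.\<close>

definition wait :: "state \<Rightarrow> kind \<Rightarrow> (kind \<times> nat \<Rightarrow> real) \<Rightarrow> ennreal" where
  "wait x k w = (case ahead x k of None \<Rightarrow> 0 | Some i \<Rightarrow> match_time k i (Lone_Free, w))"

lemma measurable_wait: "wait x k \<in> borel_measurable (PiM UNIV (\<lambda>_. borel))"
  unfolding wait_def by (cases "ahead x k") simp_all

lemma waiting_time_eq_wait:
  "waiting_time \<omega> m = wait (fst ((next_sample ^^ m) \<omega>)) (kind_at \<omega> m) (snd ((next_sample ^^ Suc m) \<omega>))"
proof (cases "ahead (fst ((next_sample ^^ m) \<omega>)) (kind_at \<omega> m)")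
  case None
  obtain k' ks where "map fst (queue \<omega> m) = k' # ks" "opposes k' (kind_at \<omega> m)"
    using ahead_None[OF None] by (metis map_fst_queue)
  then obtain x xs where x: "queue \<omega> m = x # xs" "opposes (fst x) (kind_at \<omega> m)"
    by (cases "queue \<omega> m") auto
  then have "queue \<omega> (Suc m) = xs" by (simp add: can_oppose_iff)
  moreover have "(kind_at \<omega> m, Some m) \<notin> set xs"
    using queue_tags[of "kind_at \<omega> m" m \<omega> m] x by auto
  \<comment> \<open>The index \<open>j = m\<close> is already admissible and contributes the value
    0.\<close>
  ultimately have "waiting_time \<omega> m \<le> ennreal (time_at \<omega> m - time_at \<omega> m)"
    unfolding waiting_time_def by (intro INF_lower) simp
  then show ?thesis by (simp add: wait_def None)
next
  case (Some i)
  let ?k = "kind_at \<omega> m" and ?\<omega> = "(next_sample ^^ Suc m) \<omega>"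
  have gone: "(?k, Some m) \<notin> set (queue \<omega> (Suc m + n)) \<longleftrightarrow> i < opposers ?k ?\<omega> n" for n
    using queue_after_joining[OF Some, of n] by (auto split: if_splits)
  \<comment> \<open>Index \<open>j = m\<close> does not qualify, since the player has just joined;
    the first candidate is \<open>Suc m\<close>, which is arrival 0 of the shifted sample.\<close>
  have "{j. m \<le> j \<and> (?k, Some m) \<notin> set (queue \<omega> (Suc j))} = (\<lambda>n. Suc (m + n)) ` {n. i < opposers ?k ?\<omega> (Suc n)}"
  proof (intro set_eqI iffI)
    fix j assume j: "j \<in> {j. m \<le> j \<and> (?k, Some m) \<notin> set (queue \<omega> (Suc j))}"
    then have "i < opposers ?k ?\<omega> (j - m)" using gone[of "j - m"] by simp
    then show "j \<in> (\<lambda>n. Suc (m + n)) ` {n. i < opposers ?k ?\<omega> (Suc n)}"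
      using j by (cases "j - m") (auto simp: image_iff intro!: exI[of _ "j - m - 1"])
  next
    fix j assume "j \<in> (\<lambda>n. Suc (m + n)) ` {n. i < opposers ?k ?\<omega> (Suc n)}"
    then obtain n where n: "j = Suc (m + n)" "i < opposers ?k ?\<omega> (Suc n)" by auto
    show "j \<in> {j. m \<le> j \<and> (?k, Some m) \<notin> set (queue \<omega> (Suc j))}"
      using gone[of "Suc n", THEN iffD2, OF n(2)] n(1) by (simp del: queue.simps)
  qed
  then have "waiting_time \<omega> m = match_time ?k i ?\<omega>"
    by (simp only: waiting_time_def match_time_def image_comp comp_def time_at_funpow)
  also have "\<dots> = match_time ?k i (Lone_Free, snd ?\<omega>)"
    by (rule match_time_snd) simp
  finally show ?thesis by (simp add: wait_def Some)
qed

section \<open>The mean time to a match\<close>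

context matchmaking begin

definition opp_rate :: "kind \<Rightarrow> real" where
  "opp_rate k = (\<Sum>k' | opposes k k'. lam k')"

lemma opp_rate_pos: "opp_rate k > 0"
proof -
  have "(if k = SideA then SideB else SideA) \<in> {k'. opposes k k'}"
    by (auto simp: opposes_def)
  then show ?thesis unfolding opp_rate_def by (intro sum_pos lam_pos) auto
qed

lemma opp_rate_le: "opp_rate k \<le> total"
  unfolding opp_rate_def total_def using lam_pos by (intro sum_mono2) (auto intro: less_imp_le)

lemma nn_integral_clock_ident: "(\<integral>\<^sup>+t. ennreal t \<partial>clock total) = ennreal (1 / total)"
proof -
  have "(\<integral>\<^sup>+t. ennreal t \<partial>clock total) = (\<integral>\<^sup>+t. ennreal (exponential_density total t * t ^ 1) \<partial>lborel)"
    using total_pos by (subst nn_integral_clock) (auto intro!: nn_integral_cong simp: exponential_density_def ennreal_mult)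
  then show ?thesis using nn_integral_erlang_ith_moment[OF total_pos, of 0 1] by simp
qed

text \<open>The first arrival comes after mean time \<open>1 / total\<close>, is opposing with
  probability \<open>opp_rate k / total\<close>, and leaves fresh clocks: \<open>h'\<close> is the
  continuation after an opposing arrival, \<open>h\<close> the one after any other.\<close>

lemma nn_integral_opposing_step:
  assumes [measurable]: "h \<in> borel_measurable (PiM UNIV (\<lambda>_. borel))" "h' \<in> borel_measurable (PiM UNIV (\<lambda>_. borel))"
  shows "(\<integral>\<^sup>+w. ennreal (w (first w, 0)) +
      (if opposes k (first w) then h' (shift (first w) w) else h (shift (first w) w)) \<partial>clocks lam) =
    ennreal (1 / total) + ennreal (opp_rate k / total) * (\<integral>\<^sup>+w. h' w \<partial>clocks lam) +
      ennreal (1 - opp_rate k / total) * (\<integral>\<^sup>+w. h w \<partial>clocks lam)"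
proof -
  interpret C: prob_space "clock total" by (rule prob_clock[OF total_pos])
  have [simp]: "emeasure (clock total) UNIV = 1" "emeasure (clocks lam) UNIV = 1"
    using C.emeasure_space_1 clocks.emeasure_space_1 by simp_all
  define g where "g k' = (if opposes k k' then h' else h)" for k'
  have [measurable]: "g k' \<in> borel_measurable (PiM UNIV (\<lambda>_. borel))" for k'
    by (simp add: g_def)
  have sum1: "(\<Sum>k'\<in>UNIV. ennreal (lam k' / total)) = 1"
    using lam_pos total_pos by (simp add: less_imp_le sum_divide_distrib[symmetric] total_def[symmetric])
  have o: "(\<Sum>k' | opposes k k'. ennreal (lam k' / total)) = ennreal (opp_rate k / total)"
    using lam_pos total_pos by (simp add: less_imp_le opp_rate_def sum_divide_distrib[symmetric])
  have "total = opp_rate k + (\<Sum>k' | \<not> opposes k k'. lam k')"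
    unfolding total_def opp_rate_def by (subst sum.union_disjoint[symmetric]) (auto intro: sum.cong)
  then have "1 - opp_rate k / total = (\<Sum>k' | \<not> opposes k k'. lam k') / total"
    using total_pos by (simp add: field_simps)
  then have no: "(\<Sum>k' | \<not> opposes k k'. ennreal (lam k' / total)) = ennreal (1 - opp_rate k / total)"
    using lam_pos total_pos by (simp add: less_imp_le sum_divide_distrib[symmetric])
  have "(\<integral>\<^sup>+w. ennreal (w (first w, 0)) + g (first w) (shift (first w) w) \<partial>clocks lam) =
    (\<Sum>k'\<in>UNIV. ennreal (lam k' / total) * (\<integral>\<^sup>+t. \<integral>\<^sup>+w. ennreal t + g k' w \<partial>clocks lam \<partial>clock total))"
    by (rule nn_integral_first_arrival) measurable
  also have "\<dots> = (\<Sum>k'\<in>UNIV. ennreal (lam k' / total) * (ennreal (1 / total) + (\<integral>\<^sup>+w. g k' w \<partial>clocks lam)))"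
    by (simp add: nn_integral_add nn_integral_clock_ident)
  also have "\<dots> = ennreal (1 / total) + (\<Sum>k'\<in>UNIV. ennreal (lam k' / total) * (\<integral>\<^sup>+w. g k' w \<partial>clocks lam))"
    by (simp add: distrib_left sum.distrib sum_distrib_right[symmetric] sum1)
  also have "(\<Sum>k'\<in>UNIV. ennreal (lam k' / total) * (\<integral>\<^sup>+w. g k' w \<partial>clocks lam)) =
    (\<Sum>k'\<in>UNIV. if opposes k k' then ennreal (lam k' / total) * (\<integral>\<^sup>+w. h' w \<partial>clocks lam)
      else ennreal (lam k' / total) * (\<integral>\<^sup>+w. h w \<partial>clocks lam))"
    by (intro sum.cong) (simp_all add: g_def)
  also have "\<dots> = ennreal (opp_rate k / total) * (\<integral>\<^sup>+w. h' w \<partial>clocks lam) +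
      ennreal (1 - opp_rate k / total) * (\<integral>\<^sup>+w. h w \<partial>clocks lam)"
    by (simp add: sum.If_cases sum_distrib_right[symmetric] o no Compl_eq)
  finally show ?thesis by (simp add: g_def add.assoc if_distrib if_distribR cong: if_cong)
qed

lemma AE_match_time:
  "AE w in clocks lam. match_time k i (x, w) = ennreal (w (first w, 0)) +
    (if opposes k (first w) then case i of 0 \<Rightarrow> 0 | Suc j \<Rightarrow> match_time k j (x, shift (first w) w)
     else match_time k i (x, shift (first w) w))"
  using AE_nonneg
proof eventually_elim
  case (elim w)
  have "match_time k j (next_sample (x, w)) = match_time k j (x, shift (first w) w)" for j
    by (rule match_time_snd) (simp add: next_sample_def)
  then show ?case
    using elim by (subst match_time_rec) (simp_all add: nonneg_def kind_at_0 time_at_0 split: nat.split)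
qed

text \<open>The recursion for the mean of \<^const>\<open>match_time\<close> determines it only once it is known to be finite;
  truncation at \<open>s\<close> gives a bound that is uniform in \<open>s\<close>.\<close>
lemma nn_integral_min_match_time_le:
  assumes "s \<ge> 0"
  shows "(\<integral>\<^sup>+w. min (match_time k i (x, w)) (ennreal s) \<partial>clocks lam) \<le> ennreal (real (Suc i) / opp_rate k)"
proof (induction i rule: less_induct)
  case (less i)
  let ?o = "opp_rate k"
  let ?v = "\<lambda>i. \<integral>\<^sup>+w. min (match_time k i (x, w)) (ennreal s) \<partial>clocks lam"
  define g where "g w = (case i of 0 \<Rightarrow> 0 | Suc j \<Rightarrow> match_time k j (x, w))" for w
  have [measurable]: "g \<in> borel_measurable (PiM UNIV (\<lambda>_. borel))"
    unfolding g_def by (cases i) simp_all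
  have g: "(\<integral>\<^sup>+w. min (g w) (ennreal s) \<partial>clocks lam) \<le> ennreal (real i / ?o)"
    using less by (cases i) (simp_all add: g_def)
  have "?v i \<le> (\<integral>\<^sup>+w. ennreal (w (first w, 0)) + (if opposes k (first w) then min (g (shift (first w) w)) (ennreal s)
      else min (match_time k i (x, shift (first w) w)) (ennreal s)) \<partial>clocks lam)"
  proof (rule nn_integral_mono_AE)
    \<comment> \<open>Truncating only the continuation loses nothing, which turns the recursion into
      an inequality between truncated means.\<close>
    have *: "min (t + u) s \<le> t + min u s" for t u s :: ennreal
      by (simp add: min_def add_left_mono) (metis add_increasing le_add_same_cancel2 nle_le zero_le)
    show "AE w in clocks lam. min (match_time k i (x, w)) (ennreal s) \<le> ennreal (w (first w, 0)) +
      (if opposes k (first w) then min (g (shift (first w) w)) (ennreal s)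
      else min (match_time k i (x, shift (first w) w)) (ennreal s))"
      using AE_match_time[of k i x] by eventually_elim (auto simp: g_def *)
  qed
  also have "\<dots> = ennreal (1 / total) + ennreal (?o / total) * (\<integral>\<^sup>+w. min (g w) (ennreal s) \<partial>clocks lam) +
      ennreal (1 - ?o / total) * ?v i"
    by (rule nn_integral_opposing_step) measurable
  also have "\<dots> \<le> ennreal (1 / total) + ennreal (?o / total) * ennreal (real i / ?o) + ennreal (1 - ?o / total) * ?v i"
    by (intro add_mono mult_left_mono g order_refl) simp
  finally have le: "?v i \<le> ennreal (1 / total) + ennreal (?o / total) * ennreal (real i / ?o) + ennreal (1 - ?o / total) * ?v i" .
  \<comment> \<open>The truncated mean is at most \<open>s\<close>, hence a real number that may be
    subtracted from both sides.\<close>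
  have "?v i \<le> (\<integral>\<^sup>+w. ennreal s \<partial>clocks lam)"
    by (intro nn_integral_mono) simp
  also have "\<dots> < \<top>" using clocks.emeasure_space_1 by simp
  finally obtain v where v: "?v i = ennreal v" "v \<ge> 0" by (cases "?v i") auto
  have "v \<le> 1 / total + ?o / total * (real i / ?o) + (1 - ?o / total) * v"
    using le v opp_rate_pos[of k] opp_rate_le[of k] total_pos
    by (simp add: ennreal_mult[symmetric] ennreal_plus[symmetric] del: ennreal_plus)
  \<comment> \<open>In this form \<open>v\<close> cancels, and
    \<open>v * ?o \<le> real (Suc i)\<close> remains whatever \<open>s\<close> is.\<close>
  also have "\<dots> = v + (real (Suc i) - v * ?o) / total"
    using opp_rate_pos[of k] total_pos by (simp add: field_simps)
  finally have "v \<le> real (Suc i) / ?o"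
    using opp_rate_pos[of k] total_pos by (simp add: field_simps zero_le_divide_iff)
  then show ?case using v by (simp add: ennreal_leI)
qed

lemma nn_integral_match_time:
  "(\<integral>\<^sup>+w. match_time k i (x, w) \<partial>clocks lam) = ennreal (real (Suc i) / opp_rate k)"
proof (induction i rule: less_induct)
  case (less i)
  let ?o = "opp_rate k"
  let ?m = "\<integral>\<^sup>+w. match_time k i (x, w) \<partial>clocks lam"
  \<comment> \<open>Truncation at integers increases to \<open>y\<close>, also for
    \<open>y = \<infinity>\<close>, so monotone convergence carries the uniform bound over to the
    untruncated mean.\<close>
  have sup: "(SUP n. min y (ennreal (real n))) = y" for y :: ennreal
  proof (rule antisym)
    show "y \<le> (SUP n. min y (ennreal (real n)))"
    proof (cases y)
      case (real r)
      then have "y = min y (ennreal (real (nat \<lceil>r\<rceil>)))" by (simp add: min_def ennreal_leI)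
      then show ?thesis by (metis SUP_upper UNIV_I)
    next
      case top
      have "(SUP n. ennreal (real n)) = \<top>"
        using ennreal_SUP_of_nat_eq_top unfolding ennreal_of_nat_eq_real_of_nat .
      then show ?thesis by (simp only: top min_top order_refl)
    qed
  qed (auto intro: SUP_least)
  have "?m = (\<integral>\<^sup>+w. (SUP n. min (match_time k i (x, w)) (ennreal (real n))) \<partial>clocks lam)"
    by (simp add: sup)
  also have "\<dots> = (SUP n. \<integral>\<^sup>+w. min (match_time k i (x, w)) (ennreal (real n)) \<partial>clocks lam)"
    by (intro nn_integral_monotone_convergence_SUP)
      (auto simp: incseq_def le_fun_def intro: min.coboundedI2 ennreal_leI)
  also have "\<dots> \<le> ennreal (real (Suc i) / ?o)"
    by (intro SUP_least nn_integral_min_match_time_le) simp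
  finally have "?m < \<top>" using le_less_trans ennreal_less_top by blast
  then obtain v where v: "?m = ennreal v" "v \<ge> 0" by (cases ?m) auto
  define g where "g w = (case i of 0 \<Rightarrow> 0 | Suc j \<Rightarrow> match_time k j (x, w))" for w
  have [measurable]: "g \<in> borel_measurable (PiM UNIV (\<lambda>_. borel))"
    unfolding g_def by (cases i) simp_all
  have g: "(\<integral>\<^sup>+w. g w \<partial>clocks lam) = ennreal (real i / ?o)"
    using less by (cases i) (simp_all add: g_def)
  have "?m = (\<integral>\<^sup>+w. ennreal (w (first w, 0)) + (if opposes k (first w) then g (shift (first w) w)
      else match_time k i (x, shift (first w) w)) \<partial>clocks lam)"
    unfolding g_def by (rule nn_integral_cong_AE[OF AE_match_time])
  also have "\<dots> = ennreal (1 / total) + ennreal (?o / total) * ennreal (real i / ?o) + ennreal (1 - ?o / total) * ?m"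
    unfolding g[symmetric] by (rule nn_integral_opposing_step) measurable
  \<comment> \<open>Now that the mean is known to be finite, the exact recursion is a linear
    equation with a unique solution.\<close>
  finally have "v = 1 / total + ?o / total * (real i / ?o) + (1 - ?o / total) * v"
    using v opp_rate_pos[of k] opp_rate_le[of k] total_pos
    by (simp add: ennreal_mult[symmetric] ennreal_plus[symmetric] del: ennreal_plus)
  also have "\<dots> = v + (real (Suc i) - v * ?o) / total"
    using opp_rate_pos[of k] total_pos by (simp add: field_simps)
  finally have "v = real (Suc i) / ?o"
    using opp_rate_pos[of k] total_pos by (simp add: field_simps)
  then show ?case using v by simp
qed

lemma nn_integral_wait:
  "(\<integral>\<^sup>+w. wait x k w \<partial>clocks lam) = (case ahead x k of None \<Rightarrow> 0 | Some i \<Rightarrow> ennreal (real (Suc i) / opp_rate k))"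
  by (simp add: wait_def nn_integral_match_time split: option.split)

end

section \<open>The stationary distribution\<close>

lemma suminf_ennreal_Suc: "g 0 + (\<Sum>n. g (Suc n)) = (\<Sum>n. g n :: ennreal)"
  using suminf_offset[of g 1] by (simp add: add.commute)

lemma suminf_ennreal_geometric_Suc: "0 \<le> x \<Longrightarrow> x < 1 \<Longrightarrow> (\<Sum>n. ennreal (x ^ Suc n)) = ennreal (x / (1 - x))" for x :: real
  using sums_mult[OF geometric_sums[of x], of x] by (intro suminf_ennreal_eq) auto

lemma nn_integral_count_space_state:
  fixes f :: "state \<Rightarrow> ennreal"
  shows "(\<integral>\<^sup>+x. f x \<partial>count_space UNIV) =
    f (Net 0) + (\<Sum>n. f (Net (int (Suc n)))) + (\<Sum>n. f (Net (- int (Suc n)))) + f Lone_Free"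
proof -
  let ?P = "\<lambda>n. Net (int (Suc n))" and ?N = "\<lambda>n. Net (- int (Suc n))"
  have inj: "(\<integral>\<^sup>+x. f x * indicator (range h) x \<partial>count_space UNIV) = (\<Sum>n. f (h n))" if "inj h" for h :: "nat \<Rightarrow> state"
    using nn_integral_bij_count_space[OF inj_on_imp_bij_betw[OF that], of f]
    by (simp add: nn_integral_count_space_indicator nn_integral_count_space_nat)
  have "x = Net 0 \<or> x \<in> range ?P \<or> x \<in> range ?N \<or> x = Lone_Free" for x
  proof (cases x)
    case (Net i)
    then show ?thesis by (cases i rule: int_cases3) (auto simp: image_iff gr0_conv_Suc)
  qed simp
  moreover have "range ?P \<inter> range ?N = {}" "Net 0 \<notin> range ?P" "Net 0 \<notin> range ?N" by auto
  ultimately have "f x = f x * indicator {Net 0} x + f x * indicator (range ?P) x + f x * indicator (range ?N) x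
      + f x * indicator {Lone_Free} x" for x
    by (fastforce simp: indicator_def)
  then have "(\<integral>\<^sup>+x. f x \<partial>count_space UNIV) = (\<integral>\<^sup>+x. f x * indicator {Net 0} x + f x * indicator (range ?P) x
      + f x * indicator (range ?N) x + f x * indicator {Lone_Free} x \<partial>count_space UNIV)"
    by presburger
  also have "\<dots> = (\<integral>\<^sup>+x. f x * indicator {Net 0} x \<partial>count_space UNIV) + (\<Sum>n. f (?P n)) + (\<Sum>n. f (?N n))
      + (\<integral>\<^sup>+x. f x * indicator {Lone_Free} x \<partial>count_space UNIV)"
    using inj[of ?P] inj[of ?N] by (simp add: nn_integral_add inj_on_def)
  finally show ?thesis by (simp add: nn_integral_count_space_finite flip: nn_integral_count_space_indicator)
qed

text \<open>The net flux \<open>a * p n - d * p (n + 1)\<close> is constant, hence zero.\<close>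
lemma birth_death_geometric:
  fixes p :: "nat \<Rightarrow> real"
  assumes "d > 0" and bal: "\<And>n. a * p n + d * p (Suc (Suc n)) = (a + d) * p (Suc n)" and lim: "p \<longlonglongrightarrow> 0"
  shows "p n = (a / d) ^ n * p 0"
proof -
  define J where "J n = a * p n - d * p (Suc n)" for n
  have "J (Suc n) = J n" for n using bal[of n] by (simp add: J_def algebra_simps)
  then have const: "J n = J 0" for n by (induction n) auto
  have "J \<longlonglongrightarrow> a * 0 - d * 0"
    unfolding J_def by (intro tendsto_intros lim LIMSEQ_Suc)
  then have "J 0 = 0"
    using const LIMSEQ_unique[of J "J 0" 0] by (simp add: tendsto_cong[of J "\<lambda>_. J 0"])
  then have "p (Suc n) = a / d * p n" for n
    using const[of n] \<open>d > 0\<close> by (simp add: J_def field_simps)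
  then show ?thesis by (induction n) auto
qed

text \<open>The boundary condition at infinity, which rules out a nonzero constant flux along a
  half-line.\<close>

lemma pmf_tendsto_0:
  assumes "inj h"
  shows "(\<lambda>n. pmf \<pi> (h n)) \<longlonglongrightarrow> 0"
proof -
  have "summable (\<lambda>n. pmf \<pi> (h n))"
  proof (rule summableI_nonneg_bounded)
    fix n
    have "(\<Sum>i<n. pmf \<pi> (h i)) = measure_pmf.prob \<pi> (h ` {..<n})"
      using assms by (simp add: measure_measure_pmf_finite sum.reindex inj_on_subset comp_def)
    then show "(\<Sum>i<n. pmf \<pi> (h i)) \<le> 1" by simp
  qed simp
  then show ?thesis by (rule summable_LIMSEQ_zero)
qed

section \<open>Geometric tails and normalisation\<close>

locale matchmaking_rates = matchmaking +
  fixes a b c :: real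
  assumes rates: "lam SideA = a" "lam SideB = b" "lam Free = c"
    and stable: "c > \<bar>a - b\<bar>"
begin

lemma a_pos: "a > 0" and b_pos: "b > 0" and c_pos: "c > 0"
  using lam_pos rates by metis+

lemma total_eq: "total = a + b + c"
  by (simp add: total_def UNIV_kind rates)

definition up :: real where "up = a / (b + c)"
definition down :: real where "down = b / (a + c)"

text \<open>The condition \<open>c > \<bar>a - b\<bar>\<close> says that \<open>a < b + c\<close>
  and \<open>b < a + c\<close>, so both geometric tails are summable.\<close>

lemma up: "0 < up" "up < 1" and down: "0 < down" "down < 1"
  using a_pos b_pos c_pos stable by (auto simp: up_def down_def)

text \<open>The stationary measure scaled to 1 at \<open>Net 0\<close>; the value
  \<open>c / total\<close> comes from the balance at \<open>Lone_Free\<close>.\<close>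

fun weight :: "state \<Rightarrow> real" where
  "weight (Net i) = (if i \<ge> 0 then up ^ nat i else down ^ nat (- i))"
| "weight Lone_Free = c / total"

definition norm_const :: real where
  "norm_const = a / (b + c - a) + b / (a + c - b) + c / total + 1"

lemma weight_Net: "weight (Net (int n)) = up ^ n" "weight (Net (- int n)) = down ^ n"
  by simp (cases "n = 0", auto)

lemma weight_nonneg: "weight x \<ge> 0"
  using up down c_pos total_pos by (cases x) auto

lemma norm_const_pos: "norm_const > 0"
  using a_pos b_pos c_pos total_pos stable by (auto simp: norm_const_def intro!: add_nonneg_pos)

lemma nn_integral_weight: "(\<integral>\<^sup>+x. ennreal (weight x) \<partial>count_space UNIV) = ennreal norm_const"
proof -
  have "up / (1 - up) = a / (b + c - a)" "down / (1 - down) = b / (a + c - b)"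
    using a_pos b_pos c_pos by (simp_all add: up_def down_def divide_simps)
  moreover have "0 \<le> a / (b + c - a)" "0 \<le> b / (a + c - b)"
    using a_pos b_pos c_pos stable by auto
  ultimately show ?thesis
    using weight_nonneg[of Lone_Free] up down
    unfolding nn_integral_count_space_state weight_Net suminf_ennreal_geometric_Suc[OF less_imp_le[OF up(1)] up(2)]
      suminf_ennreal_geometric_Suc[OF less_imp_le[OF down(1)] down(2)]
    by (simp add: norm_const_def add_ac flip: ennreal_plus ennreal_1)
qed

text \<open>Global balance splits into a second-order recurrence along each half-line, of the kind
  solved by \<open>birth_death_geometric\<close>, and one equation at each of \<open>Net 0\<close>
  and \<open>Lone_Free\<close>.\<close>

lemma stationary_iff_balance:
  "stationary_distribution lam \<pi> \<longleftrightarrow>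
    (\<forall>n. a * pmf \<pi> (Net (int n)) + (b + c) * pmf \<pi> (Net (int (Suc (Suc n)))) = (a + (b + c)) * pmf \<pi> (Net (int (Suc n)))) \<and>
    (\<forall>n. b * pmf \<pi> (Net (- int n)) + (a + c) * pmf \<pi> (Net (- int (Suc (Suc n)))) = (b + (a + c)) * pmf \<pi> (Net (- int (Suc n)))) \<and>
    (a + c) * pmf \<pi> (Net (- 1)) + (b + c) * pmf \<pi> (Net 1) + total * pmf \<pi> Lone_Free = total * pmf \<pi> (Net 0) \<and>
    pmf \<pi> (Net 0) * c = pmf \<pi> Lone_Free * total"
  (is "_ \<longleftrightarrow> (\<forall>n. ?P n) \<and> (\<forall>n. ?N n) \<and> ?Z \<and> ?L")
proof -
  define B where "B y \<longleftrightarrow> (\<Sum>x\<in>pred_states y. pmf \<pi> x * rate lam x y) = pmf \<pi> y * total" for y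
  have all: "(\<forall>y. B y) \<longleftrightarrow> (\<forall>n. B (Net (int (Suc n)))) \<and> (\<forall>n. B (Net (- int (Suc n)))) \<and> B (Net 0) \<and> B Lone_Free"
  proof (intro iffI allI)
    fix y assume *: "(\<forall>n. B (Net (int (Suc n)))) \<and> (\<forall>n. B (Net (- int (Suc n)))) \<and> B (Net 0) \<and> B Lone_Free"
    show "B y"
    proof (cases y)
      case (Net i)
      then show ?thesis using * by (cases i rule: int_cases3) (auto simp: gr0_conv_Suc)
    qed (use * in simp)
  qed auto
  have "B (Net (int (Suc n))) \<longleftrightarrow> ?P n" for n
    by (auto simp: B_def pred_states_def rates total_eq algebra_simps)
  moreover have "B (Net (- int (Suc n))) \<longleftrightarrow> ?N n" for n
    by (auto simp: B_def pred_states_def rates total_eq algebra_simps)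
  moreover have "B (Net 0) \<longleftrightarrow> ?Z"
    by (auto simp: B_def pred_states_def rates total_eq algebra_simps)
  moreover have "B Lone_Free \<longleftrightarrow> ?L"
    by (auto simp: B_def pred_states_def rates total_eq algebra_simps)
  ultimately show ?thesis
    using all by (simp add: stationary_distribution_iff B_def total_def[symmetric])
qed

lemma stationary_imp_pmf:
  assumes "stationary_distribution lam \<pi>"
  shows "pmf \<pi> x = weight x / norm_const"
proof -
  note bal = assms[unfolded stationary_iff_balance]
  have pos: "pmf \<pi> (Net (int n)) = up ^ n * pmf \<pi> (Net 0)" for n
    using birth_death_geometric[of "b + c" a "\<lambda>n. pmf \<pi> (Net (int n))" n] bal b_pos c_pos
      pmf_tendsto_0[of "\<lambda>n. Net (int n)" \<pi>] by (simp add: up_def inj_on_def)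
  have neg: "pmf \<pi> (Net (- int n)) = down ^ n * pmf \<pi> (Net 0)" for n
    using birth_death_geometric[of "a + c" b "\<lambda>n. pmf \<pi> (Net (- int n))" n] bal a_pos c_pos
      pmf_tendsto_0[of "\<lambda>n. Net (- int n)" \<pi>] by (simp add: down_def inj_on_def)
  have scaled_Net: "pmf \<pi> (Net i) = weight (Net i) * pmf \<pi> (Net 0)" for i
  proof (cases "i \<ge> 0")
    case True
    then show ?thesis using pos[of "nat i"] by simp
  next
    case False
    then show ?thesis using neg[of "nat (- i)"] by simp
  qed
  have scaled: "pmf \<pi> x = weight x * pmf \<pi> (Net 0)" for x
  proof (cases x)
    case (Net i)
    show ?thesis unfolding Net by (rule scaled_Net)
  next
    case Lone_Free
    then show ?thesis using bal total_pos by (simp add: field_simps)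
  qed
  \<comment> \<open>Balance fixes the distribution up to the factor
    \<open>pmf \<pi> (Net 0)\<close>; total mass 1 fixes that factor.\<close>
  have "1 = (\<integral>\<^sup>+x. ennreal (weight x) * ennreal (pmf \<pi> (Net 0)) \<partial>count_space UNIV)"
    using nn_integral_pmf[of UNIV \<pi>] weight_nonneg
    by (simp add: measure_pmf.emeasure_space_1[simplified] flip: ennreal_mult scaled)
  also have "\<dots> = ennreal (norm_const * pmf \<pi> (Net 0))"
    using norm_const_pos by (simp add: nn_integral_multc nn_integral_weight ennreal_mult)
  finally have "norm_const * pmf \<pi> (Net 0) = 1"
    by (metis ennreal_eq_1)
  then show ?thesis using scaled[of x] norm_const_pos by (simp add: field_simps)
qed

lemma stationary_exists: "\<exists>\<pi>. stationary_distribution lam \<pi>"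
proof
  have pmf: "pmf (embed_pmf (\<lambda>x. weight x / norm_const)) x = weight x / norm_const" for x
  proof (rule pmf_embed_pmf)
    have "(\<integral>\<^sup>+x. ennreal (weight x / norm_const) \<partial>count_space UNIV) = (\<integral>\<^sup>+x. ennreal (weight x) / ennreal norm_const \<partial>count_space UNIV)"
      using norm_const_pos weight_nonneg by (simp add: divide_ennreal)
    then show "(\<integral>\<^sup>+x. ennreal (weight x / norm_const) \<partial>count_space UNIV) = 1"
      using norm_const_pos by (simp add: nn_integral_divide nn_integral_weight)
  qed (use norm_const_pos weight_nonneg in \<open>simp add: less_imp_le\<close>)
  have w1: "weight (Net 1) = up" "weight (Net (- 1)) = down" "weight (Net 0) = 1" by simp_all
  \<comment> \<open>Flow balance across a single edge: the geometric weights satisfy it, and the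
    balance at each state follows by combining the edges at that state.\<close>
  have u: "a = up * (b + c)" "b = down * (a + c)"
    using a_pos b_pos c_pos by (auto simp: up_def down_def)
  have uu: "a * up ^ n + (b + c) * up ^ Suc (Suc n) = (a + (b + c)) * up ^ Suc n" for n
    by (subst (1 2) u(1)) (simp add: algebra_simps)
  have dd: "b * down ^ n + (a + c) * down ^ Suc (Suc n) = (b + (a + c)) * down ^ Suc n" for n
    by (subst (1 2) u(2)) (simp add: algebra_simps)
  have bal: "(a + c) * down + (b + c) * up + total * (c / total) = total"
    using u total_pos by (simp add: total_eq mult.commute)
  show "stationary_distribution lam (embed_pmf (\<lambda>x. weight x / norm_const))"
    unfolding stationary_iff_balance pmf weight_Net w1 weight.simps(2) times_divide_eq_right add_divide_distrib[symmetric] uu dd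
    using bal total_pos by (simp add: add_divide_distrib[symmetric])
qed

section \<open>Stationary means\<close>

lemma nn_integral_stationary_wait:
  assumes st: "stationary_distribution lam \<pi>"
  shows "(\<integral>\<^sup>+x. \<integral>\<^sup>+w. wait x SideA w \<partial>clocks lam \<partial>\<pi>) = ennreal ((b + c) * pmf \<pi> (Net 0) / (b + c - a)\<^sup>2)"
    and "(\<integral>\<^sup>+x. \<integral>\<^sup>+w. wait x SideB w \<partial>clocks lam \<partial>\<pi>) = ennreal ((a + c) * pmf \<pi> (Net 0) / (a + c - b)\<^sup>2)"
    and "(\<integral>\<^sup>+x. \<integral>\<^sup>+w. wait x Free w \<partial>clocks lam \<partial>\<pi>) = ennreal (pmf \<pi> (Net 0) / total)"
proof -
  let ?p0 = "pmf \<pi> (Net 0)"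
  have "?p0 = 1 / norm_const" using stationary_imp_pmf[OF st, of "Net 0"] by simp
  then have pmf: "pmf \<pi> x = weight x * ?p0" for x
    using stationary_imp_pmf[OF st, of x] by simp
  have opp: "opp_rate SideA = b + c" "opp_rate SideB = a + c" "opp_rate Free = total"
  proof -
    have "{k'. opposes SideA k'} = {SideB, Free}" "{k'. opposes SideB k'} = {SideA, Free}" "{k'. opposes Free k'} = UNIV"
      by (auto simp: opposes_def) (metis kind.exhaust)+
    then show "opp_rate SideA = b + c" "opp_rate SideB = a + c" "opp_rate Free = total"
      by (simp_all add: opp_rate_def rates total_def)
  qed
  \<comment> \<open>The series of \<open>(n + 1) * x ^ n\<close> is the derivative of the geometric
    series; it is the source of the squares in the result.\<close>
  have sum: "(\<Sum>n. ennreal (x ^ n * ?p0) * ennreal (real (Suc n) / d)) = ennreal (?p0 / d / (1 - x)\<^sup>2)"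
    if "0 \<le> x" "x < 1" "d > 0" for x d
  proof -
    have "(\<lambda>n. ?p0 / d * (real (Suc n) * x ^ n)) sums (?p0 / d * (1 / (1 - x)\<^sup>2))"
      using that by (intro sums_mult geometric_deriv_sums) auto
    then have "(\<Sum>n. ennreal (?p0 / d * (real (Suc n) * x ^ n))) = ennreal (?p0 / d * (1 / (1 - x)\<^sup>2))"
      using that by (intro suminf_ennreal_eq) auto
    then show ?thesis using that by (simp add: mult_ac flip: ennreal_mult)
  qed
  have E: "(\<integral>\<^sup>+x. f x \<partial>\<pi>) = ennreal ?p0 * f (Net 0) + (\<Sum>n. ennreal (up ^ Suc n * ?p0) * f (Net (int (Suc n))))
      + (\<Sum>n. ennreal (down ^ Suc n * ?p0) * f (Net (- int (Suc n)))) + ennreal (pmf \<pi> Lone_Free) * f Lone_Free" for f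
    unfolding nn_integral_measure_pmf nn_integral_count_space_state pmf[of "Net (int _)"] pmf[of "Net (- int _)"] weight_Net ..
  have "(\<integral>\<^sup>+x. \<integral>\<^sup>+w. wait x SideA w \<partial>clocks lam \<partial>\<pi>) =
    (\<Sum>n. ennreal (up ^ n * ?p0) * ennreal (real (Suc n) / (b + c)))"
    \<comment> \<open>A side-A player waits exactly in the states \<open>Net i\<close> with
      \<open>i \<ge> 0\<close>. The empty state supplies the term \<open>n = 0\<close> missing from
      the sum over positive states.\<close>
    unfolding E nn_integral_wait opp by (subst suminf_ennreal_Suc[symmetric]) simp
  also have "\<dots> = ennreal (?p0 / (b + c) / (1 - up)\<^sup>2)"
    using up b_pos c_pos by (intro sum) auto
  also have "?p0 / (b + c) / (1 - up)\<^sup>2 = (b + c) * ?p0 / (b + c - a)\<^sup>2"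
  proof -
    have "1 - up = (b + c - a) / (b + c)" using b_pos c_pos by (simp add: up_def field_simps)
    then show ?thesis using b_pos c_pos by (simp add: power_divide power2_eq_square)
  qed
  finally show "(\<integral>\<^sup>+x. \<integral>\<^sup>+w. wait x SideA w \<partial>clocks lam \<partial>\<pi>) = ennreal ((b + c) * ?p0 / (b + c - a)\<^sup>2)" .
  have "(\<integral>\<^sup>+x. \<integral>\<^sup>+w. wait x SideB w \<partial>clocks lam \<partial>\<pi>) =
    (\<Sum>n. ennreal (down ^ n * ?p0) * ennreal (real (Suc n) / (a + c)))"
    unfolding E nn_integral_wait opp by (subst suminf_ennreal_Suc[symmetric]) simp
  also have "\<dots> = ennreal (?p0 / (a + c) / (1 - down)\<^sup>2)"
    using down a_pos c_pos by (intro sum) auto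
  also have "?p0 / (a + c) / (1 - down)\<^sup>2 = (a + c) * ?p0 / (a + c - b)\<^sup>2"
  proof -
    have "1 - down = (a + c - b) / (a + c)" using a_pos c_pos by (simp add: down_def field_simps)
    then show ?thesis using a_pos c_pos by (simp add: power_divide power2_eq_square)
  qed
  finally show "(\<integral>\<^sup>+x. \<integral>\<^sup>+w. wait x SideB w \<partial>clocks lam \<partial>\<pi>) = ennreal ((a + c) * ?p0 / (a + c - b)\<^sup>2)" .
  show "(\<integral>\<^sup>+x. \<integral>\<^sup>+w. wait x Free w \<partial>clocks lam \<partial>\<pi>) = ennreal (?p0 / total)"
    unfolding E nn_integral_wait opp using total_pos by (simp flip: ennreal_mult)
qed

lemma mean_waiting_time_stationary:
  assumes st: "stationary_distribution lam \<pi>"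
  shows "mean_waiting_time lam \<pi> K =
    (\<Sum>k\<in>K. ennreal (lam k) * (\<integral>\<^sup>+x. \<integral>\<^sup>+w. wait x k w \<partial>clocks lam \<partial>\<pi>)) / ennreal (\<Sum>k\<in>K. lam k)"
  by (subst mean_waiting_time_eq[OF st measurable_wait waiting_time_eq_wait])
    (simp add: nn_integral_sum nn_integral_cmult)

lemma mean_waiting_time_kind:
  assumes "stationary_distribution lam \<pi>"
  shows "mean_waiting_time lam \<pi> {k} = (\<integral>\<^sup>+x. \<integral>\<^sup>+w. wait x k w \<partial>clocks lam \<partial>\<pi>)"
  using lam_pos[of k] by (simp add: mean_waiting_time_stationary[OF assms] ennreal_mult_divide_eq mult.commute[of "ennreal (lam k)"])

text \<open>The closed form is a partial fraction decomposition: over the common denominator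
  \<open>2 * c * Q * u * v * total\<close> it becomes a polynomial identity.\<close>

lemma mean_waiting_time_generic:
  assumes st: "stationary_distribution lam \<pi>"
  shows "mean_waiting_time lam \<pi> UNIV =
    ennreal (1 / (2 * (a + c - b)) + 1 / (2 * (b + c - a)) + 1 / (a + b + c) - 1 / (2 * c)
      - (a + b + 2 * c) / (2 * (2 * a * b + a * c + b * c + c\<^sup>2)))"
proof -
  let ?p0 = "pmf \<pi> (Net 0)"
  have p0: "?p0 = 1 / norm_const" using stationary_imp_pmf[OF st, of "Net 0"] by simp
  define u where "u = b + c - a"
  define v where "v = a + c - b"
  define Q where "Q = 2 * a * b + a * c + b * c + c\<^sup>2"
  have pos: "u > 0" "v > 0" "Q > 0" "total > 0" "a > 0" "b > 0" "c > 0"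
    using stable total_pos a_pos b_pos c_pos by (auto simp: u_def v_def Q_def intro!: add_pos_pos)
  have "mean_waiting_time lam \<pi> UNIV = (ennreal a * ennreal ((b + c) * ?p0 / u\<^sup>2) + ennreal b * ennreal ((a + c) * ?p0 / v\<^sup>2)
      + ennreal c * ennreal (?p0 / total)) / ennreal total"
    unfolding mean_waiting_time_stationary[OF st] total_def[symmetric]
    by (simp add: UNIV_kind rates nn_integral_stationary_wait[OF st] u_def v_def add_ac)
  also have "\<dots> = ennreal ((a * ((b + c) * ?p0 / u\<^sup>2) + b * ((a + c) * ?p0 / v\<^sup>2) + c * (?p0 / total)) / total)"
    using pos by (simp add: divide_ennreal flip: ennreal_mult ennreal_plus)
  also have "(a * ((b + c) * ?p0 / u\<^sup>2) + b * ((a + c) * ?p0 / v\<^sup>2) + c * (?p0 / total)) / total =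
     1 / (2 * v) + 1 / (2 * u) + 1 / (a + b + c) - 1 / (2 * c) - (a + b + 2 * c) / (2 * Q)"
  proof -
    \<comment> \<open>The numerator over the common denominator collapses to
      \<open>2 * c * Q\<close>, which is where \<open>Q\<close> originates.\<close>
    have "norm_const = (a * v * total + b * u * total + c * u * v + u * v * total) / (u * v * total)"
      using pos by (simp add: norm_const_def flip: u_def v_def) (simp add: field_simps)
    also have "a * v * total + b * u * total + c * u * v + u * v * total = 2 * c * Q"
      by (simp add: u_def v_def Q_def total_eq algebra_simps power2_eq_square)
    finally have p0: "?p0 = u * v * total / (2 * c * Q)" using p0 pos by simp
    have "(a * ((b + c) * ?p0 / u\<^sup>2) + b * ((a + c) * ?p0 / v\<^sup>2) + c * (?p0 / total)) / total =
      (a * (b + c) * v\<^sup>2 * total + b * (a + c) * u\<^sup>2 * total + c * u\<^sup>2 * v\<^sup>2) / (2 * c * Q * u * v * total)"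
      unfolding p0 using pos by (simp add: field_simps power2_eq_square)
    \<comment> \<open>The four products on the right are the numerators of
      \<open>c / (u * v)\<close>, \<open>1 / total\<close>, \<open>1 / (2 * c)\<close> and
      \<open>(a + b + 2 * c) / (2 * Q)\<close> over the common denominator.\<close>
    also have "a * (b + c) * v\<^sup>2 * total + b * (a + c) * u\<^sup>2 * total + c * u\<^sup>2 * v\<^sup>2 =
      2 * c\<^sup>2 * Q * total + 2 * c * Q * u * v - Q * u * v * total - (a + b + 2 * c) * c * u * v * total"
      by (simp add: u_def v_def Q_def total_eq algebra_simps power2_eq_square)
    also have "\<dots> / (2 * c * Q * u * v * total) = c / (u * v) + 1 / total - 1 / (2 * c) - (a + b + 2 * c) / (2 * Q)"
      using pos by (simp add: field_simps power2_eq_square)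
    \<comment> \<open>Since \<open>u + v = 2 * c\<close>, this term splits into the two fractions of
      the theorem.\<close>
    also have "c / (u * v) = 1 / (2 * v) + 1 / (2 * u)"
    proof -
      have "c = (u + v) / 2" by (simp add: u_def v_def)
      then show ?thesis using pos by (simp add: field_simps)
    qed
    finally show ?thesis by (simp add: total_eq)
  qed
  finally show ?thesis by (simp add: u_def v_def Q_def)
qed

end

theorem mainTheorem4:
  fixes lam :: "kind \<Rightarrow> real" and a b c total :: real
  assumes "lam SideA = a" and "lam SideB = b" and "lam Free = c" and "total = a + b + c"
    and "a > 0" and "b > 0" and "c > 0" and "c > \<bar>a - b\<bar>"
  shows "(\<exists>!\<pi>. stationary_distribution lam \<pi>) \<and>
    (\<forall>\<pi>. stationary_distribution lam \<pi> \<longrightarrow>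
      mean_waiting_time lam \<pi> {SideA} = ennreal ((b + c) * pmf \<pi> (Net 0) / (b + c - a)\<^sup>2) \<and>
      mean_waiting_time lam \<pi> {SideB} = ennreal ((a + c) * pmf \<pi> (Net 0) / (a + c - b)\<^sup>2) \<and>
      mean_waiting_time lam \<pi> {Free} = ennreal (pmf \<pi> (Net 0) / (a + b + c)) \<and>
      pmf \<pi> (Net 0) = inverse (a / (b + c - a) + b / (a + c - b) + c / total + 1) \<and>
      mean_waiting_time lam \<pi> UNIV =
        ennreal (1 / (2 * (a + c - b)) + 1 / (2 * (b + c - a)) + 1 / (a + b + c) - 1 / (2 * c)
          - (a + b + 2 * c) / (2 * (2 * a * b + a * c + b * c + c\<^sup>2))))"
proof -
  have pos: "lam k > 0" for k using assms by (cases k) auto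
  interpret matchmaking_rates lam a b c
    by unfold_locales (use pos assms in auto)
  have "\<exists>!\<pi>. stationary_distribution lam \<pi>"
    using stationary_exists stationary_imp_pmf by (metis pmf_eqI)
  moreover have "pmf \<pi> (Net 0) = inverse (a / (b + c - a) + b / (a + c - b) + c / total + 1)"
    if "stationary_distribution lam \<pi>" for \<pi>
    using stationary_imp_pmf[OF that, of "Net 0"]
    by (simp add: norm_const_def inverse_eq_divide total_eq assms(4))
  ultimately show ?thesis
    by (auto simp: mean_waiting_time_kind nn_integral_stationary_wait mean_waiting_time_generic total_eq)
qed

end
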